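(* Let $H$ be an algebra with a PBW generating system $\mathbb G=(\{z_\xi\}_{\xi\in\Xi},<)$, let $\Delta\colon H\to H\otimes H$ be an algebra homomorphism, and let $A\subseteq H$ be a subalgebra such that either $\Delta(A)\subseteq A\otimes H$ or $\Delta(A)\subseteq H\otimes A$. Assume that $\mathbb G$ is $\mathfrak d$-triangular and $(\Delta,\mathfrak d)$-dominated for some order-preserving positive map $\mathfrak d\colon\Xi\to\Gamma$. Put $$\Xi'=\Xi(A,\mathbb G,\mathfrak d):=\{\xi\in\Xi\mid (z_\xi+H[\mathbb G,\xi,\mathfrak d])\cap A\neq\emptyset\}.$$ If $\hat{\mathbb G}=(\{\hat z_\xi\}_{\xi\in\Xi},<)$ is any $\mathfrak d$-thin replacement of $\mathbb G$ such that $\hat z_\xi\in A$ for all $\xi\in\Xi'$, then the restricted ordered family $\hat{\mathbb G}|_{\Xi'}=(\{\hat z_\xi\}_{\xi\in\Xi'},<|_{\Xi'})$ is a PBW generating system of $A$ and is $\mathfrak d|_{\Xi'}$-triangular.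
   Context: $\Bbbk$ is a field of characteristic zero; algebras and tensor products are over $\Bbbk$. An ordered family $\mathbb G=(\{z_\xi\}_{\xi\in\Xi},<)$ in an algebra $H$ is a family of elements of $H$ together with a total order $<$ on $\Xi$. $\mathcal P(\Xi)$ is the set (free monoid) of words on $\Xi$, with empty word $\emptyset$; $\mathcal P(\Xi,<)$ is the set of non-decreasing words $\xi_1\cdots\xi_n$, $\xi_1\le\cdots\le\xi_n$ (including $\emptyset$); $\mathcal P_+(\Xi,<)=\mathcal P(\Xi,<)\setminus\{\emptyset\}$. For $V=\xi_1\cdots\xi_n$ put $z_V=z_{\xi_1}\cdots z_{\xi_n}$, $z_\emptyset=1$. $\mathbb G$ is a PBW generating system of $H$ if $\{z_V\}_{V\in\mathcal P(\Xi,<)}$ is a basis of $H$. Orders on words: $U<_{\mathfrak r}V$ iff $U=W_1\eta W_3$, $V=W_2\xi W_3$ for some words $W_i$ and letters $\eta<\xi$. $U<_{\mathfrak r,\mathrm{lex}}V$ iff $U$ is a proper suffix of $V$ or $U<_{\mathfrak r}V$. $\Gamma$ is a nontrivial free abelian monoid with a well order $<$ such that $\gamma_1<\gamma_2$ implies $\gamma_1+\gamma<\gamma_2+\gamma$. A map $\mathfrak d\colon\Xi\to\Gamma$ is positive if $\mathfrak d(\xi)>0$ for all $\xi$, and order-preserving if $\eta<\xi$ implies $\mathfrak d(\eta)\le\mathfrak d(\xi)$; it is extended to words by $\mathfrak d(\xi_1\cdots\xi_n)=\sum_i\mathfrak d(\xi_i)$. $\mathbb G$ is $\mathfrak d$-triangular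 if for every $\gamma\in\Gamma$ the restriction of $<$ to $\mathfrak d^{-1}(\gamma)\subseteq\Xi$ is well-founded, and for all $\eta<\xi$ in $\Xi$: $z_\xi z_\eta\in\Bbbk^\times z_\eta z_\xi+\operatorname{Span}\{z_W\mid W\in\mathcal P_+(\Xi,<),\ \mathfrak d(W)\le\mathfrak d(\eta\xi),\ W<_{\mathfrak r,\mathrm{lex}}\eta\xi\}$. $\mathbb G$ is $(\Delta,\mathfrak d)$-dominated if for all $\xi\in\Xi$: $\Delta(z_\xi)\in 1\otimes z_\xi+z_\xi\otimes1+\operatorname{Span}\{z_P\otimes z_Q\mid P,Q\in\mathcal P_+(\Xi,<),\ \mathfrak d(PQ)\le\mathfrak d(\xi),\ P<_{\mathfrak r}\xi,\ Q<_{\mathfrak r}\xi\}$. For $V\in\mathcal P(\Xi,<)$: $H[\mathbb G,V,\mathfrak d]=\operatorname{Span}\{z_W\mid W\in\mathcal P(\Xi,<),\ \mathfrak d(W)\le\mathfrak d(V),\ W<_{\mathfrak r,\mathrm{lex}}V\}$, and $H_+[\mathbb G,V,\mathfrak d]$ is the same span over $W\in\mathcal P_+(\Xi,<)$ only. A $\mathfrak d$-thin replacement of $\mathbb G$ is an ordered family $\hat{\mathbb G}=(\{\hat z_\xi\}_{\xi\in\Xi},<)$ with the same ordered index set such that $\hat z_\xi-z_\xi\in H_+[\mathbb G,\xi,\mathfrak d]$ for all $\xi\in\Xi$. *)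

theory Defs
  imports Complex_Main "HOL-Library.Multiset" "HOL-Library.Sublist" "HOL-Library.Poly_Mapping"
begin

section \<open>Algebras over a field\<close>

locale algebra_over = vector_space scale
  for scale :: "'k::field \<Rightarrow> 'h::ring_1 \<Rightarrow> 'h" +
  assumes scale_mult_left: "scale c x * y = scale c (x * y)"
    and scale_mult_right: "x * scale c y = scale c (x * y)"

definition subalgebra :: "('k::field \<Rightarrow> 'h::ring_1 \<Rightarrow> 'h) \<Rightarrow> 'h set \<Rightarrow> bool" where
  "subalgebra scale A \<longleftrightarrow>
     module.subspace scale A \<and> 1 \<in> A \<and> (\<forall>x\<in>A. \<forall>y\<in>A. x * y \<in> A)"

definition algebra_hom ::
    "('k::field \<Rightarrow> 'h::ring_1 \<Rightarrow> 'h) \<Rightarrow> ('k \<Rightarrow> 't::ring_1 \<Rightarrow> 't) \<Rightarrow> ('h \<Rightarrow> 't) \<Rightarrow> bool" where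
  "algebra_hom scale scaleT f \<longleftrightarrow>
     Vector_Spaces.linear scale scaleT f \<and> f 1 = 1 \<and> (\<forall>x y. f (x * y) = f x * f y)"


section \<open>Tensor products\<close>

text \<open>The free vector space on a type is the type of finitely supported functions
  with pointwise scaling; the linear extension of a map on basis elements is \<open>free_ext\<close>.\<close>

definition free_scale :: "'k::field \<Rightarrow> ('b \<Rightarrow>\<^sub>0 'k) \<Rightarrow> ('b \<Rightarrow>\<^sub>0 'k)" where
  "free_scale c = Poly_Mapping.map ((*) c)"

definition free_ext ::
    "('k::field \<Rightarrow> 't::ab_group_add \<Rightarrow> 't) \<Rightarrow> ('b \<Rightarrow> 't) \<Rightarrow> ('b \<Rightarrow>\<^sub>0 'k) \<Rightarrow> 't" where
  "free_ext scale f p = (\<Sum>b\<in>Poly_Mapping.keys p. scale (Poly_Mapping.lookup p b) (f b))"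

definition bilinear_relators ::
    "('k::field \<Rightarrow> 'v::ab_group_add \<Rightarrow> 'v) \<Rightarrow> ('k \<Rightarrow> 'w::ab_group_add \<Rightarrow> 'w)
       \<Rightarrow> ('v \<times> 'w \<Rightarrow>\<^sub>0 'k) set" where
  "bilinear_relators scaleV scaleW =
     {Poly_Mapping.single (x + x', y) 1 - Poly_Mapping.single (x, y) 1
        - Poly_Mapping.single (x', y) 1 | x x' y. True} \<union>
     {Poly_Mapping.single (x, y + y') 1 - Poly_Mapping.single (x, y) 1
        - Poly_Mapping.single (x, y') 1 | x y y'. True} \<union>
     {Poly_Mapping.single (scaleV c x, y) 1 - Poly_Mapping.single (x, y) c | c x y. True} \<union>
     {Poly_Mapping.single (x, scaleW c y) 1 - Poly_Mapping.single (x, y) c | c x y. True}"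

text \<open>A type cannot depend on the scalar multiplications, so the tensor product is specified up to
  isomorphism: \<open>T\<close> together with \<open>tens\<close> is a tensor product of \<open>V\<close> and \<open>W\<close> if the map from the free
  vector space on \<open>V \<times> W\<close> to \<open>T\<close> induced by \<open>tens\<close> is onto and its kernel is spanned by the
  bilinearity relations, i.e. if it exhibits \<open>T\<close> as the usual quotient.  The universal property
  (for arbitrary target types) is derived below.\<close>

definition is_tensor_product ::
    "('k::field \<Rightarrow> 'v::ab_group_add \<Rightarrow> 'v) \<Rightarrow> ('k \<Rightarrow> 'w::ab_group_add \<Rightarrow> 'w) \<Rightarrow>
     ('k \<Rightarrow> 't::ab_group_add \<Rightarrow> 't) \<Rightarrow> ('v \<Rightarrow> 'w \<Rightarrow> 't) \<Rightarrow> bool" where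
  "is_tensor_product scaleV scaleW scaleT tens \<longleftrightarrow>
     vector_space scaleV \<and> vector_space scaleW \<and> vector_space scaleT \<and>
     surj (free_ext scaleT (case_prod tens)) \<and>
     {p. free_ext scaleT (case_prod tens) p = 0} =
       module.span free_scale (bilinear_relators scaleV scaleW)"

definition is_tensor_algebra ::
    "('k::field \<Rightarrow> 'h::ring_1 \<Rightarrow> 'h) \<Rightarrow> ('k \<Rightarrow> 't::ring_1 \<Rightarrow> 't) \<Rightarrow> ('h \<Rightarrow> 'h \<Rightarrow> 't) \<Rightarrow> bool" where
  "is_tensor_algebra scale scaleT tens \<longleftrightarrow>
     algebra_over scale \<and> algebra_over scaleT \<and>
     is_tensor_product scale scale scaleT tens \<and>
     tens 1 1 = 1 \<and>
     (\<forall>a b c d. tens a b * tens c d = tens (a * c) (b * d))"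

lemma lookup_free_scale: "Poly_Mapping.lookup (free_scale c p) b = c * Poly_Mapping.lookup p b"
  unfolding free_scale_def by (simp add: Poly_Mapping.map.rep_eq when_def)

lemma vector_space_free_scale:
  "vector_space (free_scale :: 'k::field \<Rightarrow> ('b \<Rightarrow>\<^sub>0 'k) \<Rightarrow> ('b \<Rightarrow>\<^sub>0 'k))"
  by standard (auto intro!: poly_mapping_eqI simp: lookup_free_scale lookup_add algebra_simps)

lemma free_ext_superset:
  assumes "vector_space scale" "finite S" "Poly_Mapping.keys p \<subseteq> S"
  shows "free_ext scale f p = (\<Sum>b\<in>S. scale (Poly_Mapping.lookup p b) (f b))"
proof -
  interpret vector_space scale by fact
  show ?thesis
    unfolding free_ext_def
    by (rule sum.mono_neutral_left) (use assms in \<open>auto simp: in_keys_iff\<close>)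
qed

lemma linear_free_ext:
  assumes "vector_space scale"
  shows "Vector_Spaces.linear free_scale scale (free_ext scale f)"
proof -
  interpret T: vector_space scale by fact
  interpret F: vector_space free_scale by (rule vector_space_free_scale)
  have add: "free_ext scale f (p + q) = free_ext scale f p + free_ext scale f q" for p q
  proof -
    let ?S = "Poly_Mapping.keys p \<union> Poly_Mapping.keys q"
    have "free_ext scale f (p + q) = (\<Sum>b\<in>?S. scale (Poly_Mapping.lookup (p + q) b) (f b))"
      by (rule free_ext_superset[OF assms]) (use Poly_Mapping.keys_add[of p q] in auto)
    also have "\<dots> = (\<Sum>b\<in>?S. scale (Poly_Mapping.lookup p b) (f b))
        + (\<Sum>b\<in>?S. scale (Poly_Mapping.lookup q b) (f b))"
      by (simp add: lookup_add T.scale_left_distrib sum.distrib)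
    also have "\<dots> = free_ext scale f p + free_ext scale f q"
      using free_ext_superset[OF assms, of ?S p f] free_ext_superset[OF assms, of ?S q f] by simp
    finally show ?thesis .
  qed
  have scl: "free_ext scale f (free_scale c p) = scale c (free_ext scale f p)" for c p
  proof -
    have "free_ext scale f (free_scale c p)
        = (\<Sum>b\<in>Poly_Mapping.keys p. scale (Poly_Mapping.lookup (free_scale c p) b) (f b))"
      by (rule free_ext_superset[OF assms]) (auto simp: in_keys_iff lookup_free_scale)
    also have "\<dots> = scale c (free_ext scale f p)"
      by (simp add: free_ext_def lookup_free_scale T.scale_sum_right)
    finally show ?thesis .
  qed
  show ?thesis
    by (intro Vector_Spaces.linear.intro module_hom.intro module_hom_axioms.intro add scl
        vector_space_free_scale assms F.module_axioms T.module_axioms)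
qed

lemma free_ext_single:
  assumes "vector_space scale"
  shows "free_ext scale f (Poly_Mapping.single b c) = scale c (f b)"
proof -
  interpret vector_space scale by fact
  show ?thesis by (cases "c = 0") (auto simp: free_ext_def)
qed

text \<open>Universal property.\<close>

theorem tensor_product_universal:
  fixes scaleU :: "'k::field \<Rightarrow> 'u::ab_group_add \<Rightarrow> 'u"
  assumes T: "is_tensor_product scaleV scaleW scaleT tens"
    and U: "vector_space scaleU"
    and lin1: "\<And>y. Vector_Spaces.linear scaleV scaleU (\<lambda>x. \<beta> x y)"
    and lin2: "\<And>x. Vector_Spaces.linear scaleW scaleU (\<beta> x)"
  shows "\<exists>!L. Vector_Spaces.linear scaleT scaleU L \<and> (\<forall>x y. L (tens x y) = \<beta> x y)"
proof -
  have vs: "vector_space scaleV" "vector_space scaleW" "vector_space scaleT"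
    using T by (auto simp: is_tensor_product_def)
  define e where "e = free_ext scaleT (case_prod tens)"
  define g where "g = free_ext scaleU (case_prod \<beta>)"
  have surj: "surj e"
    and ker: "{p. e p = 0} = module.span free_scale (bilinear_relators scaleV scaleW)"
    using T by (auto simp: is_tensor_product_def e_def)
  interpret T: vector_space scaleT by fact
  interpret U: vector_space scaleU by fact
  interpret F: vector_space free_scale by (rule vector_space_free_scale)
  interpret E: Vector_Spaces.linear free_scale scaleT e
    unfolding e_def by (rule linear_free_ext) fact
  interpret G: Vector_Spaces.linear free_scale scaleU g
    unfolding g_def by (rule linear_free_ext) fact
  note b1 = Vector_Spaces.linear.axioms(3)[OF lin1] and b2 = Vector_Spaces.linear.axioms(3)[OF lin2]
  have gs: "g (Poly_Mapping.single (x, y) c) = scaleU c (\<beta> x y)" for x y c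
    unfolding g_def by (simp add: free_ext_single[OF U])
  have rel: "g p = 0" if "p \<in> bilinear_relators scaleV scaleW" for p
    using that
    by (auto simp: bilinear_relators_def G.diff gs
        module_hom.add[OF b1] module_hom.add[OF b2] module_hom.scale[OF b1] module_hom.scale[OF b2])
  have g0: "g p = 0" if "e p = 0" for p
  proof -
    have "p \<in> F.span (bilinear_relators scaleV scaleW)" using that ker by auto
    thus ?thesis
      by (induction rule: F.span_induct_alt) (auto simp: G.add G.scale rel)
  qed
  have geq: "g p = g q" if "e p = e q" for p q
    using g0[of "p - q"] that by (simp add: E.diff G.diff)
  define L where "L = (\<lambda>t. g (inv e t))"
  have Le: "L (e p) = g p" for p
    unfolding L_def by (rule geq) (simp add: surj_f_inv_f[OF surj])
  have tens_eq: "tens x y = e (Poly_Mapping.single (x, y) 1)" for x y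
    unfolding e_def by (simp add: free_ext_single[OF vs(3)])
  have linL: "Vector_Spaces.linear scaleT scaleU L"
  proof (intro Vector_Spaces.linear.intro module_hom.intro module_hom_axioms.intro
      vs U T.module_axioms U.module_axioms)
    fix s t c
    obtain p q where pq: "s = e p" "t = e q" using surj by (metis surjD)
    show "L (s + t) = L s + L t" unfolding pq by (simp add: Le G.add flip: E.add)
    show "L (scaleT c s) = scaleU c (L s)" unfolding pq by (simp add: Le G.scale flip: E.scale)
  qed
  have L\<beta>: "L (tens x y) = \<beta> x y" for x y
    unfolding tens_eq Le gs by simp
  show ?thesis
  proof (rule ex1I[of _ L])
    show "Vector_Spaces.linear scaleT scaleU L \<and> (\<forall>x y. L (tens x y) = \<beta> x y)"
      using linL L\<beta> by auto
  next
    fix M assume M: "Vector_Spaces.linear scaleT scaleU M \<and> (\<forall>x y. M (tens x y) = \<beta> x y)"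
    interpret M: Vector_Spaces.linear scaleT scaleU M using M by auto
    have "M (e p) = g p" for p
      unfolding e_def g_def free_ext_def by (auto simp: M.sum M.scale M intro!: sum.cong)
    thus "M = L" by (metis Le surj surjD ext)
  qed
qed


section \<open>Words\<close>

text \<open>An ordered family is given by an index set \<open>\<Xi>\<close> in a linearly ordered type and a function \<open>z\<close>
  of which only the values on \<open>\<Xi>\<close> matter; restricting the family means shrinking \<open>\<Xi>\<close>.\<close>

definition nd_words :: "'i::linorder set \<Rightarrow> 'i list set" where
  "nd_words \<Xi> = {W. set W \<subseteq> \<Xi> \<and> sorted W}"

definition nd_words_pos :: "'i::linorder set \<Rightarrow> 'i list set" where
  "nd_words_pos \<Xi> = nd_words \<Xi> - {[]}"

definition word_prod :: "('i \<Rightarrow> 'h::monoid_mult) \<Rightarrow> 'i list \<Rightarrow> 'h" where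
  "word_prod z W = prod_list (map z W)"

definition word_deg :: "('i \<Rightarrow> 'g::comm_monoid_add) \<Rightarrow> 'i list \<Rightarrow> 'g" where
  "word_deg d W = sum_list (map d W)"

definition less_r :: "'i::linorder list \<Rightarrow> 'i list \<Rightarrow> bool" where
  "less_r U V \<longleftrightarrow>
     (\<exists>W1 W2 W3 \<eta> \<xi>. U = W1 @ \<eta> # W3 \<and> V = W2 @ \<xi> # W3 \<and> \<eta> < \<xi>)"

definition less_rlex :: "'i::linorder list \<Rightarrow> 'i list \<Rightarrow> bool" where
  "less_rlex U V \<longleftrightarrow> strict_suffix U V \<or> less_r U V"


section \<open>PBW generating systems\<close>

text \<open>A free commutative monoid on \<open>B\<close>: every element is the sum of a unique multiset over \<open>B\<close>.\<close>

definition free_comm_monoid_on :: "'g::comm_monoid_add set \<Rightarrow> bool" where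
  "free_comm_monoid_on B \<longleftrightarrow> bij_betw sum_mset {M. set_mset M \<subseteq> B} UNIV"

definition positive_on :: "'i set \<Rightarrow> ('i \<Rightarrow> 'g::{zero,ord}) \<Rightarrow> bool" where
  "positive_on \<Xi> d \<longleftrightarrow> (\<forall>\<xi>\<in>\<Xi>. 0 < d \<xi>)"

text \<open>\<open>z\<^sub>W\<close>, for \<open>W\<close> a non-decreasing word, is a basis as a family, hence the injectivity.\<close>

definition pbw_system ::
    "('k::field \<Rightarrow> 'h::ring_1 \<Rightarrow> 'h) \<Rightarrow> 'h set \<Rightarrow> 'i::linorder set \<Rightarrow> ('i \<Rightarrow> 'h) \<Rightarrow> bool" where
  "pbw_system scale A \<Xi> z \<longleftrightarrow>
     inj_on (word_prod z) (nd_words \<Xi>) \<and>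
     \<not> module.dependent scale (word_prod z ` nd_words \<Xi>) \<and>
     module.span scale (word_prod z ` nd_words \<Xi>) = A"

definition lower_span ::
    "('k::field \<Rightarrow> 'h::ring_1 \<Rightarrow> 'h) \<Rightarrow> 'i::linorder set \<Rightarrow> ('i \<Rightarrow> 'h) \<Rightarrow>
     ('i \<Rightarrow> 'g::{comm_monoid_add,ord}) \<Rightarrow> 'i list \<Rightarrow> 'h set" where
  "lower_span scale \<Xi> z d V = module.span scale
     {word_prod z W | W. W \<in> nd_words \<Xi> \<and> word_deg d W \<le> word_deg d V \<and> less_rlex W V}"

definition lower_span_pos ::
    "('k::field \<Rightarrow> 'h::ring_1 \<Rightarrow> 'h) \<Rightarrow> 'i::linorder set \<Rightarrow> ('i \<Rightarrow> 'h) \<Rightarrow>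
     ('i \<Rightarrow> 'g::{comm_monoid_add,ord}) \<Rightarrow> 'i list \<Rightarrow> 'h set" where
  "lower_span_pos scale \<Xi> z d V = module.span scale
     {word_prod z W | W. W \<in> nd_words_pos \<Xi> \<and> word_deg d W \<le> word_deg d V \<and> less_rlex W V}"

definition triangular ::
    "('k::field \<Rightarrow> 'h::ring_1 \<Rightarrow> 'h) \<Rightarrow> 'i::linorder set \<Rightarrow> ('i \<Rightarrow> 'h) \<Rightarrow>
     ('i \<Rightarrow> 'g::{comm_monoid_add,ord}) \<Rightarrow> bool" where
  "triangular scale \<Xi> z d \<longleftrightarrow>
     (\<forall>\<gamma>. wfp_on {\<xi>\<in>\<Xi>. d \<xi> = \<gamma>} (<)) \<and>
     (\<forall>\<eta>\<in>\<Xi>. \<forall>\<xi>\<in>\<Xi>. \<eta> < \<xi> \<longrightarrow>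
        (\<exists>c. c \<noteq> 0 \<and> z \<xi> * z \<eta> - scale c (z \<eta> * z \<xi>) \<in> lower_span_pos scale \<Xi> z d [\<eta>, \<xi>]))"

definition dominated ::
    "('k::field \<Rightarrow> 't::ring_1 \<Rightarrow> 't) \<Rightarrow> ('h::ring_1 \<Rightarrow> 'h \<Rightarrow> 't) \<Rightarrow> ('h \<Rightarrow> 't) \<Rightarrow>
     'i::linorder set \<Rightarrow> ('i \<Rightarrow> 'h) \<Rightarrow> ('i \<Rightarrow> 'g::{comm_monoid_add,ord}) \<Rightarrow> bool" where
  "dominated scaleT tens \<Delta> \<Xi> z d \<longleftrightarrow>
     (\<forall>\<xi>\<in>\<Xi>. \<Delta> (z \<xi>) - (tens 1 (z \<xi>) + tens (z \<xi>) 1) \<in> module.span scaleT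
        {tens (word_prod z P) (word_prod z Q) | P Q.
           P \<in> nd_words_pos \<Xi> \<and> Q \<in> nd_words_pos \<Xi> \<and>
           word_deg d (P @ Q) \<le> d \<xi> \<and> less_r P [\<xi>] \<and> less_r Q [\<xi>]})"

definition thin_replacement ::
    "('k::field \<Rightarrow> 'h::ring_1 \<Rightarrow> 'h) \<Rightarrow> 'i::linorder set \<Rightarrow> ('i \<Rightarrow> 'h) \<Rightarrow>
     ('i \<Rightarrow> 'g::{comm_monoid_add,ord}) \<Rightarrow> ('i \<Rightarrow> 'h) \<Rightarrow> bool" where
  "thin_replacement scale \<Xi> z d z' \<longleftrightarrow>
     (\<forall>\<xi>\<in>\<Xi>. z' \<xi> - z \<xi> \<in> lower_span_pos scale \<Xi> z d [\<xi>])"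

definition sub_index ::
    "('k::field \<Rightarrow> 'h::ring_1 \<Rightarrow> 'h) \<Rightarrow> 'h set \<Rightarrow> 'i::linorder set \<Rightarrow> ('i \<Rightarrow> 'h) \<Rightarrow>
     ('i \<Rightarrow> 'g::{comm_monoid_add,ord}) \<Rightarrow> 'i set" where
  "sub_index scale A \<Xi> z d =
     {\<xi>\<in>\<Xi>. ((+) (z \<xi>) ` lower_span scale \<Xi> z d [\<xi>]) \<inter> A \<noteq> {}}"

end

(* Non-decreasing words are encoded as multisets of letters; on them the order less_rlex is the
   multiset order. Triangularity lets one sort any word at the cost of lower terms, so a thin
   replacement is unitriangular in the PBW basis, hence again a basis.

   The point is that if z_V is the leading monomial of an element a of A, for monomials ordered
   first by degree and then by the multiset order, then every letter xi of V lies in Xi'.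
   Domination gives Delta(z_V) = sum of z_P (x) z_Q over the splittings of V into two subwords, up
   to lower terms. Applying to the factor outside A the functional that reads off the coefficient
   of z_{V - xi} maps Delta(a) to an element of A of the form m z_xi + lower terms, where m is
   the leading coefficient times the multiplicity of xi in V, nonzero because of
   characteristic zero. Subtracting multiples of hat z_V and descending along the
   well-founded order, A is spanned by the hat z_V with V over Xi'. *)

theory Submission
  imports Defs "HOL-Library.Multiset_Order"
begin

section \<open>Word orders as multiset orders\<close>

text \<open>A proper suffix is a proper submultiset. In the other case the common suffix cancels,
  and since \<open>U\<close> is sorted every letter left in it is at most \<eta>, so the single
  letter \<xi> of \<open>V\<close> dominates them all.\<close>

lemma less_rlex_imp_mset_less:
  assumes "sorted U" "sorted V" "less_rlex U V"
  shows "mset U < mset V"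
  using assms(3) unfolding less_rlex_def
proof
  assume "strict_suffix U V"
  then obtain X where "V = X @ U" "X \<noteq> []"
    by (auto simp: strict_suffix_def suffix_def)
  then show ?thesis
    by (intro subset_imp_less_mset) (simp add: subset_mset.less_le)
next
  assume "less_r U V"
  then obtain W1 W2 W3 \<eta> \<xi> where W: "U = W1 @ \<eta> # W3" "V = W2 @ \<xi> # W3" "\<eta> < \<xi>"
    by (auto simp: less_r_def)
  have "\<forall>x\<in>#mset (W1 @ [\<eta>]). x < \<xi>"
    using assms(1) W by (auto simp: sorted_append)
  then have "mset (W1 @ [\<eta>]) < {#\<xi>#}" by simp
  also have "\<dots> \<le> mset (W2 @ [\<xi>])"
    by (intro subset_eq_imp_le_multiset) simp
  finally have "mset (W1 @ [\<eta>]) + mset W3 < mset (W2 @ [\<xi>]) + mset W3"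
    by (rule add_strict_right_mono)
  then show ?thesis using W by simp
qed

text \<open>Compare from the right: the last letters either differ and decide, or agree and can be
  removed. Totality then yields the converse of \<open>less_rlex_imp_mset_less\<close>.\<close>

lemma less_rlex_total: "U = V \<or> less_rlex U V \<or> less_rlex V U"
proof (induction U arbitrary: V rule: rev_induct)
  case Nil
  then show ?case
    by (cases "V = []") (auto simp: less_rlex_def strict_suffix_def)
next
  case (snoc x U)
  show ?case
  proof (cases V rule: rev_cases)
    case Nil
    then show ?thesis by (auto simp: less_rlex_def strict_suffix_def)
  next
    case (snoc V' y)
    have r: "less_rlex (X @ [x]) (Y @ [x])" if "less_rlex X Y" for X Y
      using that unfolding less_rlex_def
    proof (elim disjE)
      assume "less_r X Y"
      then obtain W1 W2 W3 a b where "X = W1 @ a # W3" "Y = W2 @ b # W3" "a < b"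
        by (auto simp: less_r_def)
      then have "X @ [x] = W1 @ a # (W3 @ [x])" "Y @ [x] = W2 @ b # (W3 @ [x])" "a < b"
        by simp_all
      then show "strict_suffix (X @ [x]) (Y @ [x]) \<or> less_r (X @ [x]) (Y @ [x])"
        unfolding less_r_def by blast
    qed (auto simp: strict_suffix_def suffix_def)
    have l: "less_rlex (X @ [a]) (Y @ [b])" if "a < b" for X Y and a b :: 'a
      using that unfolding less_rlex_def less_r_def by blast
    consider "x < y" | "y < x" | "x = y" by fastforce
    then show ?thesis
      using snoc.IH[of V'] r l snoc by cases auto
  qed
qed

lemma less_rlex_iff_mset_less:
  assumes "sorted U" "sorted V"
  shows "less_rlex U V \<longleftrightarrow> mset U < mset V"
proof -
  have "\<not> less_rlex V U" "U \<noteq> V" if "mset U < mset V"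
    using that less_rlex_imp_mset_less[OF assms(2,1)] by auto
  then show ?thesis
    using less_rlex_total[of U V] less_rlex_imp_mset_less[OF assms] by blast
qed

text \<open>In a one-letter word the common suffix is empty, so the compared letter of
  \<open>P\<close> is its last and, by sortedness, its largest.\<close>

lemma less_r_singleton: "sorted P \<Longrightarrow> less_r P [\<xi>] \<Longrightarrow> x \<in> set P \<Longrightarrow> x < \<xi>"
  by (fastforce simp: less_r_def sorted_append Cons_eq_append_conv append_eq_Cons_conv)

lemma word_prod_simps [simp]:
  "word_prod z [] = 1" "word_prod z (x # w) = z x * word_prod z w"
  "word_prod z (u @ w) = word_prod z u * word_prod z w"
  by (simp_all add: word_prod_def)

text \<open>The whole index type may contain infinite descents, so the multiset extension is formed
  from the order restricted to \<Xi>. A decrease \<open>M < N\<close> over \<Xi> is one step of that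
  extension, because the dominating letters all occur in \<open>N\<close>.\<close>

lemma wf_multiset_less_on:
  fixes \<Xi> :: "'i::linorder set"
  assumes "wfp_on \<Xi> (<)"
  shows "wf {(M, N). set_mset M \<subseteq> \<Xi> \<and> set_mset N \<subseteq> \<Xi> \<and> M < N}"
proof -
  let ?r = "{(x, y). x \<in> \<Xi> \<and> y \<in> \<Xi> \<and> x < y}"
  have "wf ?r"
    using wfp_on_iff_wfp[THEN iffD1, OF assms] unfolding wfp_def by (rule wf_subset) auto
  then have "wf (mult ?r)" by (rule wf_mult)
  then show ?thesis
  proof (rule wf_subset, safe)
    fix M N :: "'i multiset"
    assume s: "set_mset M \<subseteq> \<Xi>" "set_mset N \<subseteq> \<Xi>" and "M < N"
    then have "(M, N) \<in> mult {(x, y). x < y}"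
      by (simp add: less_multiset_def multp_def)
    moreover have "trans {(x, y). x < (y :: 'i)}"
      by (rule transI) auto
    ultimately obtain I J K
      where IJK: "N = I + J" "M = I + K" "J \<noteq> {#}" "\<forall>k\<in>#K. \<exists>j\<in>#J. k < j"
      using mult_implies_one_step[of "{(x, y). x < y}" M N] by auto
    have "\<forall>k\<in>#K. \<exists>j\<in>#J. (k, j) \<in> ?r"
    proof
      fix k assume k: "k \<in># K"
      with IJK(4) obtain j where "j \<in># J" "k < j" by blast
      with k s IJK(1,2) show "\<exists>j\<in>#J. (k, j) \<in> ?r" by auto
    qed
    then show "(M, N) \<in> mult ?r"
      unfolding IJK(1,2) by (rule one_step_implies_mult[OF IJK(3)])
  qed
qed

section \<open>Spans in independent families, and products of spans\<close>

text \<open>Over \<open>B\<close> there is only one representation of \<open>x\<close>, and it is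
  supported both in \<open>S\<close> and in \<open>T\<close>. This later restricts a bound on
  monomials to those of the subalgebra.\<close>

lemma (in vector_space) independent_span_Int:
  assumes "independent B" "S \<subseteq> B" "T \<subseteq> B" "x \<in> span S" "x \<in> span T"
  shows "x \<in> span (S \<inter> T)"
proof -
  have "representation B x = representation S x" "representation B x = representation T x"
    using assms by (auto intro: representation_extend)
  then have *: "b \<in> S \<inter> T" if "representation B x b \<noteq> 0" for b
    using that representation_ne_zero[of S x b] representation_ne_zero[of T x b] by auto
  have "x \<in> span B" using assms span_mono by blast
  then have "x = (\<Sum>b | representation B x b \<noteq> 0. scale (representation B x b) b)"
    using sum_nonzero_representation_eq[OF assms(1)] by simp
  moreover have "(\<Sum>b | representation B x b \<noteq> 0. scale (representation B x b) b) \<in> span (S \<inter> T)"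
    using * by (intro span_sum span_scale span_base) blast
  ultimately show ?thesis by simp
qed

context algebra_over
begin

lemma span_mult:
  assumes "x \<in> span S" "y \<in> span T" and st: "\<And>s t. s \<in> S \<Longrightarrow> t \<in> T \<Longrightarrow> s * t \<in> span U"
  shows "x * y \<in> span U"
proof -
  have *: "s * y \<in> span U" if "s \<in> S" for s
    using assms(2)
  proof (induction rule: span_induct_alt)
    case (step c t y)
    then show ?case
      using st[OF that] by (simp add: distrib_left scale_mult_right span_add span_scale)
  qed (simp add: span_zero)
  show ?thesis
    using assms(1)
    by (induction rule: span_induct_alt)
       (simp_all add: span_zero distrib_right scale_mult_left span_add span_scale *)
qed

end

section \<open>Monomials indexed by multisets\<close>

definition multisets_on :: "'i set \<Rightarrow> 'i multiset set" where
  "multisets_on X = {M. set_mset M \<subseteq> X}"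

text \<open>Sorting picks the unique non-decreasing word with the given letters, so this only
  reindexes the PBW monomials.\<close>

definition mmon :: "('i::linorder \<Rightarrow> 'h::monoid_mult) \<Rightarrow> 'i multiset \<Rightarrow> 'h" where
  "mmon z M = word_prod z (sorted_list_of_multiset M)"

lemma multisets_on_simps [simp]:
  "{#} \<in> multisets_on X" "add_mset x M \<in> multisets_on X \<longleftrightarrow> x \<in> X \<and> M \<in> multisets_on X"
  "M + N \<in> multisets_on X \<longleftrightarrow> M \<in> multisets_on X \<and> N \<in> multisets_on X"
  "mset w \<in> multisets_on X \<longleftrightarrow> set w \<subseteq> X"
  by (auto simp: multisets_on_def)

lemma mmon_mset: "sorted w \<Longrightarrow> mmon z (mset w) = word_prod z w"
  by (simp add: mmon_def sorted_sort_id)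

lemma mmon_simps [simp]: "mmon z {#} = 1" "mmon z {#x#} = z x"
  by (simp_all add: mmon_def)

lemma mmon_add_min: "(\<And>y. y \<in># M \<Longrightarrow> x \<le> y) \<Longrightarrow> mmon z (add_mset x M) = z x * mmon z M"
  unfolding mmon_def by (simp add: insort_is_Cons)

lemma nd_words_image_eq:
  "word_prod z ` {w \<in> nd_words X. P (mset w)} = mmon z ` {M \<in> multisets_on X. P M}"
proof (intro equalityI image_subsetI)
  fix w assume "w \<in> {w \<in> nd_words X. P (mset w)}"
  then have "word_prod z w = mmon z (mset w)" "mset w \<in> {M \<in> multisets_on X. P M}"
    by (auto simp: nd_words_def mmon_mset)
  then show "word_prod z w \<in> mmon z ` {M \<in> multisets_on X. P M}" by blast
next
  fix M assume "M \<in> {M \<in> multisets_on X. P M}"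
  then show "mmon z M \<in> word_prod z ` {w \<in> nd_words X. P (mset w)}"
    by (auto simp: nd_words_def mmon_def multisets_on_def)
qed

lemma inj_on_nd_words_iff: "inj_on (word_prod z) (nd_words X) \<longleftrightarrow> inj_on (mmon z) (multisets_on X)"
proof
  assume inj: "inj_on (word_prod z) (nd_words X)"
  show "inj_on (mmon z) (multisets_on X)"
  proof (rule inj_onI)
    fix M N assume "M \<in> multisets_on X" "N \<in> multisets_on X" "mmon z M = mmon z N"
    then have "sorted_list_of_multiset M = sorted_list_of_multiset N"
      by (intro inj_onD[OF inj]) (auto simp: nd_words_def mmon_def multisets_on_def)
    then show "M = N" by (metis mset_sorted_list_of_multiset)
  qed
next
  assume inj: "inj_on (mmon z) (multisets_on X)"
  show "inj_on (word_prod z) (nd_words X)"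
  proof (rule inj_onI)
    fix u w assume "u \<in> nd_words X" "w \<in> nd_words X" "word_prod z u = word_prod z w"
    then have "mset u = mset w" "sorted u" "sorted w"
      using inj_onD[OF inj, of "mset u" "mset w"] by (auto simp: nd_words_def mmon_mset)
    then show "u = w" by (metis properties_for_sort)
  qed
qed

lemma (in algebra_over) pbw_system_iff:
  "pbw_system scale A X z \<longleftrightarrow> inj_on (mmon z) (multisets_on X) \<and>
     independent (mmon z ` multisets_on X) \<and> span (mmon z ` multisets_on X) = A"
  using nd_words_image_eq[of z X "\<lambda>_. True"] by (simp add: pbw_system_def inj_on_nd_words_iff)

section \<open>Degrees and well-founded orders on monomials\<close>

locale pbw_algebra = algebra_over scale
  for scale :: "'k::field \<Rightarrow> 'h::ring_1 \<Rightarrow> 'h" +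
  fixes \<Xi> :: "'i::linorder set" and z :: "'i \<Rightarrow> 'h"
    and d :: "'i \<Rightarrow> 'g::{comm_monoid_add,wellorder}"
  assumes pbw: "pbw_system scale UNIV \<Xi> z"
    and add_less_deg: "\<And>\<gamma>1 \<gamma>2 \<gamma> :: 'g. \<gamma>1 < \<gamma>2 \<Longrightarrow> \<gamma>1 + \<gamma> < \<gamma>2 + \<gamma>"
    and d_mono: "mono_on \<Xi> d"
    and d_pos: "positive_on \<Xi> d"
    and triangular: "triangular scale \<Xi> z d"
begin

definition deg :: "'i multiset \<Rightarrow> 'g" where
  "deg M = (\<Sum>x\<in>#M. d x)"

abbreviation ms :: "'i multiset set" where
  "ms \<equiv> multisets_on \<Xi>"

abbreviation mon :: "'i multiset \<Rightarrow> 'h" where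
  "mon \<equiv> mmon z"

definition lower_ms :: "'i multiset \<Rightarrow> 'i multiset set" where
  "lower_ms M = {N \<in> ms. N \<noteq> {#} \<and> N < M \<and> deg N \<le> deg M}"

text \<open>The words need not be sorted here, so products of such spans are easy to control.
  Straightening later identifies this span with \<open>mon_span\<close>.\<close>

definition word_span :: "'i multiset \<Rightarrow> 'h set" where
  "word_span M = span (word_prod z ` {w. mset w \<in> lower_ms M})"

text \<open>For a sorted word \<open>V\<close> with letters \<open>M\<close> this is
  \<open>lower_span_pos\<close> at \<open>V\<close>, the space of admissible correction
  terms.\<close>

definition mon_span :: "'i multiset \<Rightarrow> 'h set" where
  "mon_span M = span (mon ` lower_ms M)"

text \<open>\<open>lower_ms\<close> is not total, so leading monomials are taken with respect to the total order
  \<open>deg_less\<close>, which refines it; on the multisets below a single letter the two agree.\<close>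

definition deg_less :: "'i multiset \<Rightarrow> 'i multiset \<Rightarrow> bool" where
  "deg_less M N \<longleftrightarrow> deg M < deg N \<or> deg M = deg N \<and> M < N"

lemma add_le_deg: "a \<le> b \<Longrightarrow> a + c \<le> b + (c::'g)"
  using add_less_deg[of a b c] by (auto simp: le_less)

lemma add_le_deg_left: "a \<le> b \<Longrightarrow> c + a \<le> c + (b::'g)"
  using add_le_deg[of a b c] by (simp add: add.commute)

lemma deg_simps [simp]:
  "deg {#} = 0" "deg (add_mset x M) = d x + deg M" "deg (M + N) = deg M + deg N"
  by (simp_all add: deg_def)

lemma word_deg_eq: "word_deg d w = deg (mset w)"
  by (induction w) (simp_all add: word_deg_def)

lemma deg_nonneg: "M \<in> ms \<Longrightarrow> 0 \<le> deg M"
proof (induction M)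
  case (add x M)
  then have "0 + 0 \<le> d x + 0" "d x + 0 \<le> d x + deg M"
    using d_pos add_le_deg[of 0 "deg M" "d x"] by (auto simp: positive_on_def add.commute)
  then show ?case by simp
qed simp

lemma d_le_deg:
  assumes "M \<in> ms" "x \<in># M"
  shows "d x \<le> deg M"
proof -
  obtain N where "M = add_mset x N"
    using assms(2) by (metis insert_DiffM)
  then show ?thesis
    using assms(1) add_le_deg[OF deg_nonneg, of N "d x"] by (simp add: add.commute)
qed

lemma span_mon: "span (mon ` ms) = UNIV"
  and independent_mon: "independent (mon ` ms)"
  and inj_on_mon: "inj_on mon ms"
  using pbw by (simp_all add: pbw_system_iff)

text \<open>The index set \<open>X\<close> and the family \<open>y\<close> are arbitrary so that the
  restricted replacement is covered along with the original family.\<close>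

lemma lower_span_pos_eq:
  assumes "sorted V"
  shows "lower_span_pos scale X y d V =
    span (mmon y ` {N \<in> multisets_on X. N \<noteq> {#} \<and> N < mset V \<and> deg N \<le> deg (mset V)})"
proof -
  have "{word_prod y W | W. W \<in> nd_words_pos X \<and> word_deg d W \<le> word_deg d V \<and> less_rlex W V}
      = word_prod y ` {W \<in> nd_words X. mset W \<noteq> {#} \<and> mset W < mset V
          \<and> deg (mset W) \<le> deg (mset V)}"
    using assms by (auto simp: nd_words_pos_def word_deg_eq nd_words_def less_rlex_iff_mset_less)
  also have "\<dots> = mmon y ` {N \<in> multisets_on X. N \<noteq> {#} \<and> N < mset V \<and> deg N \<le> deg (mset V)}"
    by (rule nd_words_image_eq)
  finally show ?thesis
    by (simp add: lower_span_pos_def)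
qed

text \<open>In contrast to \<open>lower_span_pos_eq\<close> the empty multiset is allowed, as
  membership in \<open>sub_index\<close> permits constants.\<close>

lemma lower_span_singleton_eq:
  "lower_span scale \<Xi> z d [\<xi>] = span (mon ` {N \<in> ms. N < {#\<xi>#} \<and> deg N \<le> d \<xi>})"
proof -
  have "{word_prod z W | W. W \<in> nd_words \<Xi> \<and> word_deg d W \<le> word_deg d [\<xi>] \<and> less_rlex W [\<xi>]}
      = word_prod z ` {W \<in> nd_words \<Xi>. mset W < {#\<xi>#} \<and> deg (mset W) \<le> d \<xi>}"
    using less_rlex_iff_mset_less[of _ "[\<xi>]"]
    by (auto simp: word_deg_eq nd_words_def)
  also have "\<dots> = mon ` {N \<in> ms. N < {#\<xi>#} \<and> deg N \<le> d \<xi>}"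
    by (rule nd_words_image_eq)
  finally show ?thesis
    by (simp add: lower_span_def)
qed

text \<open>In a nonempty subset of \<Xi> take the least degree that occurs and a minimal letter of
  that degree. A smaller letter of the subset would have at most this degree by order preservation,
  hence the same degree.\<close>

lemma wfp_on_index: "wfp_on \<Xi> (<)"
proof -
  have "wf {(x, y). x \<in> \<Xi> \<and> y \<in> \<Xi> \<and> x < y}"
  proof (rule wfI_min)
    fix x Q assume "x \<in> (Q :: 'i set)"
    show "\<exists>m\<in>Q. \<forall>y. (y, m) \<in> {(x, y). x \<in> \<Xi> \<and> y \<in> \<Xi> \<and> x < y} \<longrightarrow> y \<notin> Q"
    proof (cases "Q \<inter> \<Xi> = {}")
      case True
      then show ?thesis using \<open>x \<in> Q\<close> by blast
    next
      case False
      define \<gamma> where "\<gamma> = (LEAST \<gamma>. \<gamma> \<in> d ` (Q \<inter> \<Xi>))"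
      have \<gamma>: "\<gamma> \<in> d ` (Q \<inter> \<Xi>)"
        unfolding \<gamma>_def by (rule LeastI_ex[where P = "\<lambda>\<gamma>. \<gamma> \<in> d ` (Q \<inter> \<Xi>)"]) (use False in blast)
      have "wfp_on {\<xi>\<in>\<Xi>. d \<xi> = \<gamma>} (<)"
        using triangular by (simp add: triangular_def)
      moreover have "{\<xi> \<in> Q \<inter> \<Xi>. d \<xi> = \<gamma>} \<noteq> {}"
        using \<gamma> by blast
      moreover have "{\<xi> \<in> Q \<inter> \<Xi>. d \<xi> = \<gamma>} \<subseteq> {\<xi>\<in>\<Xi>. d \<xi> = \<gamma>}" by blast
      ultimately have "\<exists>m\<in>{\<xi> \<in> Q \<inter> \<Xi>. d \<xi> = \<gamma>}. \<forall>y. y < m \<longrightarrow> y \<notin> {\<xi> \<in> Q \<inter> \<Xi>. d \<xi> = \<gamma>}"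
        unfolding wfp_on_iff_ex_minimal by blast
      then obtain m where m: "m \<in> Q" "m \<in> \<Xi>" "d m = \<gamma>"
          "\<And>y. y < m \<Longrightarrow> y \<in> Q \<Longrightarrow> y \<in> \<Xi> \<Longrightarrow> d y \<noteq> \<gamma>"
        by blast
      have "y \<notin> Q" if "y \<in> \<Xi>" "y < m" for y
      proof
        assume "y \<in> Q"
        moreover have "d y \<le> \<gamma>"
          using d_mono m that by (auto simp: mono_on_def)
        moreover have "\<gamma> \<le> d y"
          unfolding \<gamma>_def by (rule Least_le) (use that \<open>y \<in> Q\<close> in blast)
        ultimately show False
          using m(4) that by auto
      qed
      then show ?thesis using m(1) by blast
    qed
  qed
  then have "wfp (\<lambda>x y. x < y \<and> x \<in> \<Xi> \<and> y \<in> \<Xi>)"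
    unfolding wfp_def by (rule wf_subset) auto
  then show ?thesis
    by (rule wfp_on_iff_wfp[THEN iffD2])
qed

lemma wf_less_ms: "wf {(M, N). M \<in> ms \<and> N \<in> ms \<and> M < N}"
  using wf_multiset_less_on[OF wfp_on_index] by (simp add: multisets_on_def)

lemma ms_less_induct [consumes 1, case_names less]:
  assumes "M \<in> ms" and "\<And>M. M \<in> ms \<Longrightarrow> (\<And>N. N \<in> ms \<Longrightarrow> N < M \<Longrightarrow> P N) \<Longrightarrow> P M"
  shows "P M"
  using assms(1)
proof (induction M rule: wf_induct_rule[OF wf_less_ms])
  case (1 M)
  then show ?case using assms(2)[of M] by blast
qed

text \<open>Outer induction on the degree in the well-ordered \<Gamma>, inner induction on the
  multiset order among multisets of one degree.\<close>

lemma ms_deg_less_induct [consumes 1, case_names less]: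
  assumes "M \<in> ms" and "\<And>M. M \<in> ms \<Longrightarrow> (\<And>N. N \<in> ms \<Longrightarrow> deg_less N M \<Longrightarrow> P N) \<Longrightarrow> P M"
  shows "P M"
  using assms(1)
proof (induction "deg M" arbitrary: M rule: less_induct)
  case less
  note deg_IH = this(1)
  have "deg N = deg M \<longrightarrow> P N" if "N \<in> ms" for N
    using that
  proof (induction N rule: ms_less_induct)
    case (less N)
    show ?case
    proof (rule impI, rule assms(2)[OF less(1)])
      fix L assume "deg N = deg M" "L \<in> ms" "deg_less L N"
      then show "P L"
        using deg_IH[of L] less(2)[of L] by (auto simp: deg_less_def)
    qed
  qed
  with less.prems show ?case by blast
qed

lemma deg_less_trans: "deg_less L M \<Longrightarrow> deg_less M N \<Longrightarrow> deg_less L N"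
  by (auto simp: deg_less_def)

lemma deg_less_irrefl [simp]: "\<not> deg_less M M"
  by (simp add: deg_less_def)

lemma deg_less_linear: "deg_less M N \<or> M = N \<or> deg_less N M"
  by (auto simp: deg_less_def)

lemma deg_less_add: "deg_less M N \<Longrightarrow> deg_less (M + K) (N + K)"
  by (auto simp: deg_less_def add_less_deg)

lemma deg_less_add_cancel: "deg_less (M + K) (N + K) \<longleftrightarrow> deg_less M N"
  using deg_less_add[of M N K] deg_less_add[of N M K] deg_less_linear[of M N] deg_less_trans deg_less_irrefl
  by blast

lemma lower_ms_deg_less: "N \<in> lower_ms M \<Longrightarrow> deg_less N M"
  by (auto simp: lower_ms_def deg_less_def)

text \<open>If the degree is strictly smaller, order preservation excludes every letter from \<xi>
  upwards, since one such letter alone has degree at least \<open>d \<xi>\<close>. So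
  \<open>P\<close> is also below \<xi> in the multiset order.\<close>

lemma deg_less_singleton_imp_less:
  assumes "P \<in> ms" "\<xi> \<in> \<Xi>" "deg_less P {#\<xi>#}"
  shows "P < {#\<xi>#}" "deg P \<le> d \<xi>"
proof -
  show "deg P \<le> d \<xi>" using assms(3) by (auto simp: deg_less_def)
  have "x < \<xi>" if "deg P < d \<xi>" "x \<in># P" for x
  proof (rule ccontr)
    assume "\<not> x < \<xi>"
    moreover have "x \<in> \<Xi>" using assms(1) that by (auto simp: multisets_on_def)
    ultimately have "d \<xi> \<le> d x"
      using d_mono assms(2) by (auto simp: mono_on_def)
    then show False using d_le_deg[OF assms(1) that(2)] that(1) by auto
  qed
  then show "P < {#\<xi>#}" using assms(3) by (auto simp: deg_less_def)
qed

section \<open>Straightening of words\<close>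

lemma lower_ms_add: "N \<in> lower_ms M \<Longrightarrow> K \<in> ms \<Longrightarrow> N + K \<in> lower_ms (M + K)"
  by (auto simp: lower_ms_def add_le_deg)

lemma lower_ms_add_left: "N \<in> lower_ms M \<Longrightarrow> K \<in> ms \<Longrightarrow> K + N \<in> lower_ms (K + M)"
  using lower_ms_add[of N M K] by (simp add: add.commute)

lemma lower_ms_trans: "N \<in> lower_ms M \<Longrightarrow> L \<in> lower_ms N \<Longrightarrow> L \<in> lower_ms M"
  by (auto simp: lower_ms_def)

lemma mon_span_mono: "N \<in> lower_ms M \<Longrightarrow> mon_span N \<subseteq> mon_span M"
  unfolding mon_span_def by (rule span_mono) (auto dest: lower_ms_trans)

lemma mon_span_subset_word_span: "mon_span M \<subseteq> word_span M"
  unfolding mon_span_def word_span_def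
proof (rule span_mono, safe)
  fix N assume "N \<in> lower_ms M"
  then show "mon N \<in> word_prod z ` {w. mset w \<in> lower_ms M}"
    by (auto simp: mmon_def intro!: image_eqI[of _ _ "sorted_list_of_multiset N"])
qed

lemma word_span_mult_left:
  assumes "x \<in> word_span M" "set w \<subseteq> \<Xi>"
  shows "word_prod z w * x \<in> word_span (mset w + M)"
  unfolding word_span_def
proof (rule span_mult[OF span_base[of "word_prod z w" "{word_prod z w}"]])
  show "x \<in> span (word_prod z ` {w. mset w \<in> lower_ms M})" using assms by (simp add: word_span_def)
qed (use assms(2) in \<open>auto intro!: span_base image_eqI[of _ _ "w @ _"] lower_ms_add_left\<close>)

lemma word_span_mult_right:
  assumes "x \<in> word_span M" "set w \<subseteq> \<Xi>"
  shows "x * word_prod z w \<in> word_span (M + mset w)"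
  unfolding word_span_def
proof (rule span_mult[OF _ span_base[of "word_prod z w" "{word_prod z w}"]])
  show "x \<in> span (word_prod z ` {w. mset w \<in> lower_ms M})" using assms by (simp add: word_span_def)
qed (use assms(2) in \<open>auto intro!: span_base image_eqI[of _ _ "_ @ w"] lower_ms_add\<close>)

lemma subspace_mon_span: "subspace (mon_span M)"
  and subspace_word_span: "subspace (word_span M)"
  by (simp_all add: mon_span_def word_span_def)

lemma word_span_mult: "x \<in> word_span M \<Longrightarrow> y \<in> word_span N \<Longrightarrow> x * y \<in> word_span (M + N)"
  unfolding word_span_def
proof (erule (1) span_mult, clarify)
  fix p q assume "mset p \<in> lower_ms M" "mset q \<in> lower_ms N"
  then have "mset (p @ q) \<in> lower_ms (M + N)"
    by (auto simp: lower_ms_def intro: add_strict_mono order.trans[OF add_le_deg add_le_deg_left])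
  then show "word_prod z p * word_prod z q \<in> span (word_prod z ` {w. mset w \<in> lower_ms (M + N)})"
    by (metis imageI mem_Collect_eq span_base word_prod_simps(3))
qed

lemma mon_in_mon_span: "M \<in> lower_ms V \<Longrightarrow> mon M \<in> mon_span V"
  unfolding mon_span_def by (simp add: span_base)

text \<open>Straightening is a hypothesis here because the lemma serves twice: inside the induction
  that proves \<open>straighten\<close>, and afterwards for all words.\<close>

lemma word_span_subset_mon_spanI:
  assumes "\<And>w. mset w \<in> lower_ms M \<Longrightarrow> \<exists>c. word_prod z w - scale c (mon (mset w)) \<in> mon_span (mset w)"
  shows "word_span M \<subseteq> mon_span M"
  unfolding word_span_def
proof (rule span_minimal[OF _ subspace_mon_span], safe)
  fix w assume w: "mset w \<in> lower_ms M"
  with assms obtain c where "word_prod z w - scale c (mon (mset w)) \<in> mon_span (mset w)" by blast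
  then have "(word_prod z w - scale c (mon (mset w))) + scale c (mon (mset w)) \<in> mon_span M"
    using mon_span_mono[OF w] mon_in_mon_span[OF w] by (intro subspace_add subspace_scale subspace_mon_span) auto
  then show "word_prod z w \<in> mon_span M" by simp
qed

lemma commute_in_mon_span:
  assumes "\<eta> \<in> \<Xi>" "\<xi> \<in> \<Xi>" "\<eta> < \<xi>"
  obtains c where "c \<noteq> 0" "z \<xi> * z \<eta> - scale c (z \<eta> * z \<xi>) \<in> mon_span {#\<eta>, \<xi>#}"
proof -
  have "sorted [\<eta>, \<xi>]" using assms by simp
  from lower_span_pos_eq[OF this] have "lower_span_pos scale \<Xi> z d [\<eta>, \<xi>] = mon_span {#\<eta>, \<xi>#}"
    by (simp add: mon_span_def lower_ms_def)
  then show ?thesis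
    using triangular assms that unfolding triangular_def by metis
qed

text \<open>Induction on the letters of the word in the multiset order. The tail is sorted first; if
  its smallest letter \<eta> is below the head \<open>x\<close>, triangularity moves it in front,
  and the letters behind it are sorted. All corrections have smaller content and are absorbed by the
  induction hypothesis.\<close>

lemma straighten:
  assumes "set w \<subseteq> \<Xi>"
  shows "\<exists>c. c \<noteq> 0 \<and> word_prod z w - scale c (mon (mset w)) \<in> mon_span (mset w)"
proof -
  have "\<forall>w. mset w = M \<longrightarrow>
      (\<exists>c. c \<noteq> 0 \<and> word_prod z w - scale c (mon (mset w)) \<in> mon_span (mset w))" if "M \<in> ms" for M
    using that
  proof (induction M rule: ms_less_induct)
    case (less M)
    note IH = less(2)[rule_format, OF _ _ refl]
    \<comment> \<open>Corrections may now be left as unsorted words, since everything strictly below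
      \<open>M\<close> is covered by the induction hypothesis.\<close>
    have spans_le: "word_span M \<subseteq> mon_span M"
      using IH by (intro word_span_subset_mon_spanI) (auto simp: lower_ms_def)
    show ?case
    proof safe
      fix w assume w: "M = mset w"
      show "\<exists>c. c \<noteq> 0 \<and> word_prod z w - scale c (mon (mset w)) \<in> mon_span (mset w)"
      proof (cases w)
        case Nil
        then show ?thesis
          by (intro exI[of _ 1]) (simp add: subspace_0[OF subspace_mon_span])
      next
        case (Cons x v)
        define N where "N = mset v"
        have M: "M = add_mset x N" using w Cons by (simp add: N_def)
        have x: "x \<in> \<Xi>" and N: "N \<in> ms" using less(1) M by auto
        obtain a where a: "a \<noteq> 0" "word_prod z v - scale a (mon N) \<in> mon_span N"
          using IH[of v] N M le_multiset_right_total[of N x] by (auto simp: N_def)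
        have "word_prod z [x] * (word_prod z v - scale a (mon N)) \<in> word_span (mset [x] + N)"
          using a mon_span_subset_word_span x by (intro word_span_mult_left) auto
        then have 1: "word_prod z w - scale a (z x * mon N) \<in> mon_span M"
          using spans_le Cons M by (auto simp: algebra_simps scale_mult_right)
        show ?thesis
        proof (cases "\<forall>y\<in>#N. x \<le> y")
          case True
          then have "mon M = z x * mon N" unfolding M by (intro mmon_add_min) auto
          then show ?thesis using 1 a(1) w by auto
        next
          case False
          \<comment> \<open>The smallest letter of the tail is then also the smallest letter of
            \<open>M\<close>, so it stands first in \<open>mon M\<close>.\<close>
          define \<eta> where "\<eta> = Min (set_mset N)"
          have "N \<noteq> {#}" using False by auto
          then have \<eta>: "\<eta> \<in># N" "\<And>y. y \<in># N \<Longrightarrow> \<eta> \<le> y"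
            by (auto simp: \<eta>_def)
          then have "\<eta> < x" using False by (meson le_less_trans not_le)
          obtain R where R: "N = add_mset \<eta> R" using \<eta>(1) by (metis insert_DiffM)
          have \<eta>\<Xi>: "\<eta> \<in> \<Xi>" "R \<in> ms" using N R by auto
          have monN: "mon N = z \<eta> * mon R"
            unfolding R by (rule mmon_add_min) (use \<eta> R in auto)
          have monM: "mon M = z \<eta> * mon (add_mset x R)"
            unfolding M R add_mset_commute[of x]
            by (rule mmon_add_min) (use \<eta> R \<open>\<eta> < x\<close> in auto)
          define r where "r = sorted_list_of_multiset R"
          have r: "mset r = R" "set r \<subseteq> \<Xi>" "mon R = word_prod z r"
            using \<eta>\<Xi> by (auto simp: r_def mmon_def multisets_on_def)
          obtain b where b: "b \<noteq> 0" "z x * z \<eta> - scale b (z \<eta> * z x) \<in> mon_span {#\<eta>, x#}"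
            using commute_in_mon_span[OF \<eta>\<Xi>(1) x \<open>\<eta> < x\<close>] .
          have "(z x * z \<eta> - scale b (z \<eta> * z x)) * word_prod z r \<in> word_span ({#\<eta>, x#} + mset r)"
            using b mon_span_subset_word_span r by (intro word_span_mult_right) auto
          then have 2: "z x * mon N - scale b (z \<eta> * (z x * mon R)) \<in> mon_span M"
            using spans_le monN r M R
            by (auto simp: algebra_simps scale_mult_left add_mset_commute mult.assoc)
          have "mset (x # r) < M"
            unfolding M R using r(1) le_multiset_right_total[of "add_mset x R" \<eta>]
            by (simp add: add_mset_commute)
          then obtain c where c: "c \<noteq> 0"
              "word_prod z (x # r) - scale c (mon (add_mset x R)) \<in> mon_span (add_mset x R)"
            using IH[of "x # r"] r x by auto
          have "word_prod z [\<eta>] * (word_prod z (x # r) - scale c (mon (add_mset x R)))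
              \<in> word_span (mset [\<eta>] + add_mset x R)"
            using c mon_span_subset_word_span \<eta>\<Xi> by (intro word_span_mult_left) auto
          then have 3: "z \<eta> * (z x * mon R) - scale c (mon M) \<in> mon_span M"
            using spans_le monM r M R
            by (auto simp: algebra_simps scale_mult_right add_mset_commute)
          \<comment> \<open>Telescoping sum over the three stages, whose scalars multiply.\<close>
          have "word_prod z w - scale (a * b * c) (mon M) =
              (word_prod z w - scale a (z x * mon N))
              + scale a (z x * mon N - scale b (z \<eta> * (z x * mon R)))
              + scale (a * b) (z \<eta> * (z x * mon R) - scale c (mon M))"
            by (simp add: scale_right_diff_distrib)
          also have "\<dots> \<in> mon_span M"
            using 1 2 3 by (intro subspace_add subspace_scale subspace_mon_span)
          finally show ?thesis
            using a(1) b(1) c(1) w by (intro exI[of _ "a * b * c"]) auto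
        qed
      qed
    qed
  qed
  then show ?thesis using assms by simp
qed

lemma word_span_eq_mon_span: "word_span M = mon_span M"
proof
  show "word_span M \<subseteq> mon_span M"
  proof (rule word_span_subset_mon_spanI)
    fix w assume "mset w \<in> lower_ms M"
    then have "set w \<subseteq> \<Xi>" by (simp add: lower_ms_def)
    then show "\<exists>c. word_prod z w - scale c (mon (mset w)) \<in> mon_span (mset w)"
      using straighten by blast
  qed
qed (rule mon_span_subset_word_span)

lemma word_prod_in_span:
  assumes "set w \<subseteq> \<Xi>"
  shows "word_prod z w \<in> span (mon ` insert (mset w) (lower_ms (mset w)))"
proof -
  obtain c where "word_prod z w - scale c (mon (mset w)) \<in> mon_span (mset w)"
    using straighten[OF assms] by blast
  then show ?thesis
    using span_breakdown_eq[of "word_prod z w" "mon (mset w)" "mon ` lower_ms (mset w)"]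
    by (auto simp: mon_span_def)
qed

section \<open>Leading monomials\<close>

text \<open>Since \<open>deg_less\<close> is total, the finitely many indices of a linear
  combination have a largest one. Its coefficient may still vanish, which
  \<open>leading_term\<close> repairs.\<close>

lemma leading_term_weak:
  assumes "a \<in> span (mon ` S)" "a \<noteq> 0"
  shows "\<exists>V\<in>S. a \<in> span (mon ` {N \<in> S. N = V \<or> deg_less N V})"
proof -
  have "a = 0 \<or> (\<exists>V\<in>S. a \<in> span (mon ` {N \<in> S. N = V \<or> deg_less N V}))"
    using assms(1)
  proof (induction rule: span_induct_alt)
    case (step c x y)
    then obtain M where M: "x = mon M" "M \<in> S" by blast
    let ?F = "\<lambda>V. mon ` {N \<in> S. N = V \<or> deg_less N V}"
    have x: "x \<in> span (?F V)" if "M = V \<or> deg_less M V" for V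
      using M that by (auto intro: span_base)
    from step.IH have "\<exists>V\<in>S. y \<in> span (?F V) \<and> (M = V \<or> deg_less M V)"
    proof (elim disjE bexE)
      assume "y = 0" then show ?thesis using M span_zero by blast
    next
      fix V assume V: "V \<in> S" "y \<in> span (?F V)"
      show ?thesis
      proof (cases "deg_less V M")
        case True
        then have "?F V \<subseteq> ?F M" using deg_less_trans by blast
        then show ?thesis using V M span_mono by blast
      next
        case False
        then show ?thesis using V deg_less_linear by blast
      qed
    qed
    then obtain V where "V \<in> S" "y \<in> span (?F V)" "x \<in> span (?F V)"
      using x by blast
    then show ?case using span_add span_scale by blast
  qed simp
  then show ?thesis using assms(2) by simp
qed

text \<open>While the top coefficient is zero, pass to a smaller bound; this stops because
  \<open>deg_less\<close> is well-founded on \<open>ms\<close>. A general \<open>S\<close> allows a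
  further leading term to be sought among the monomials below a given one.\<close>

lemma leading_term:
  assumes "a \<in> span (mon ` S)" "a \<noteq> 0" "S \<subseteq> ms"
  obtains V k where "V \<in> S" "k \<noteq> 0" "a - scale k (mon V) \<in> span (mon ` {N \<in> S. deg_less N V})"
proof -
  let ?F = "\<lambda>V. mon ` {N \<in> S. deg_less N V}"
  have *: "V \<in> S \<longrightarrow> a \<in> span (mon ` {N \<in> S. N = V \<or> deg_less N V}) \<longrightarrow>
      (\<exists>V\<in>S. \<exists>k. k \<noteq> 0 \<and> a - scale k (mon V) \<in> span (?F V))" if "V \<in> ms" for V
    using that
  proof (induction V rule: ms_deg_less_induct)
    case (less V)
    show ?case
    proof (intro impI)
      assume V: "V \<in> S" and "a \<in> span (mon ` {N \<in> S. N = V \<or> deg_less N V})"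
      moreover have "mon ` {N \<in> S. N = V \<or> deg_less N V} = insert (mon V) (?F V)"
        using V by auto
      ultimately obtain k where k: "a - scale k (mon V) \<in> span (?F V)"
        using span_breakdown_eq by metis
      show "\<exists>V\<in>S. \<exists>k. k \<noteq> 0 \<and> a - scale k (mon V) \<in> span (?F V)"
      proof (cases "k = 0")
        case True
        then obtain U where U: "U \<in> S" "deg_less U V"
            "a \<in> span (mon ` {N \<in> {N \<in> S. deg_less N V}. N = U \<or> deg_less N U})"
          using k leading_term_weak[of a "{N \<in> S. deg_less N V}"] assms(2) by auto
        have "a \<in> span (mon ` {N \<in> S. N = U \<or> deg_less N U})"
          using U(3) by (rule subsetD[OF span_mono, rotated]) auto
        then show ?thesis using less(2)[of U] U assms(3) by blast
      qed (use k V in blast)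
    qed
  qed
  obtain V where "V \<in> S" "a \<in> span (mon ` {N \<in> S. N = V \<or> deg_less N V})"
    using leading_term_weak[OF assms(1,2)] by blast
  then show thesis using *[of V] assms(3) that by blast
qed

lemma mon_notin_span_deg_less:
  assumes "V \<in> ms"
  shows "mon V \<notin> span (mon ` {N \<in> ms. deg_less N V})"
proof
  have "mon ` {N \<in> ms. deg_less N V} \<subseteq> mon ` ms - {mon V}"
    using assms inj_onD[OF inj_on_mon] by fastforce
  moreover assume "mon V \<in> span (mon ` {N \<in> ms. deg_less N V})"
  ultimately have "mon V \<in> span (mon ` ms - {mon V})"
    using span_mono by blast
  then show False using independent_mon assms dependent_def by blast
qed

lemma mon_span_subset_span_deg_less: "mon_span V \<subseteq> span (mon ` {N \<in> ms. deg_less N V})"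
  unfolding mon_span_def by (intro span_mono image_mono) (auto simp: lower_ms_def deg_less_def)

section \<open>Thin replacements\<close>

context
  fixes y assumes thin: "thin_replacement scale \<Xi> z d y"
begin

lemma thin_diff:
  assumes "\<xi> \<in> \<Xi>"
  shows "y \<xi> - z \<xi> \<in> mon_span {#\<xi>#}"
proof -
  have "y \<xi> - z \<xi> \<in> lower_span_pos scale \<Xi> z d [\<xi>]"
    using assms thin by (simp add: thin_replacement_def)
  then show ?thesis by (simp add: lower_span_pos_eq mon_span_def lower_ms_def)
qed

text \<open>The change in the product splits into three terms, each with a correction in at least
  one factor, and lower spans multiply into lower spans. Thus the replacement is
  unitriangular.\<close>

lemma thin_word: "set w \<subseteq> \<Xi> \<Longrightarrow> word_prod y w - word_prod z w \<in> word_span (mset w)"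
proof (induction w)
  case Nil
  then show ?case by (simp add: subspace_0[OF subspace_word_span])
next
  case (Cons x w)
  let ?\<delta> = "word_prod y w - word_prod z w"
  have 1: "y x - z x \<in> word_span {#x#}" using thin_diff[of x] Cons by (simp add: word_span_eq_mon_span)
  have 2: "?\<delta> \<in> word_span (mset w)" using Cons by simp
  have "(y x - z x) * word_prod z w \<in> word_span ({#x#} + mset w)"
    using Cons by (intro word_span_mult_right 1) simp
  moreover have "(y x - z x) * ?\<delta> \<in> word_span ({#x#} + mset w)"
    by (intro word_span_mult 1 2)
  moreover have "word_prod z [x] * ?\<delta> \<in> word_span (mset [x] + mset w)"
    using Cons by (intro word_span_mult_left 2) simp
  ultimately have "(y x - z x) * word_prod z w + (y x - z x) * ?\<delta> + z x * ?\<delta>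
      \<in> word_span (mset (x # w))"
    by (intro subspace_add subspace_word_span) auto
  then show ?case by (simp add: algebra_simps)
qed

lemma thin_mon: "M \<in> ms \<Longrightarrow> mmon y M - mon M \<in> mon_span M"
  using thin_word[of "sorted_list_of_multiset M"]
  by (simp add: mmon_def word_span_eq_mon_span multisets_on_def)

lemma thin_mon_span_deg_less: "M \<in> ms \<Longrightarrow> mmon y M - mon M \<in> span (mon ` {N \<in> ms. deg_less N M})"
  using thin_mon mon_span_subset_span_deg_less by blast

text \<open>Inversion of the unitriangular change of monomials, by induction on \<open>V\<close>.
  The bounds on degree and order survive, as triangularity of the new family requires.\<close>

lemma thin_span_lower_ms:
  assumes "V \<in> ms"
  shows "mon_span V \<subseteq> span (mmon y ` lower_ms V)"
  using assms
proof (induction V rule: ms_less_induct)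
  case (less V)
  show ?case
    unfolding mon_span_def
  proof (rule span_minimal[OF _ subspace_span], clarify)
    fix N assume N: "N \<in> lower_ms V"
    then have "mon_span N \<subseteq> span (mmon y ` lower_ms N)" using less by (auto simp: lower_ms_def)
    also have "\<dots> \<subseteq> span (mmon y ` lower_ms V)"
      using N lower_ms_trans by (intro span_mono) blast
    finally have "mmon y N - mon N \<in> span (mmon y ` lower_ms V)"
      using thin_mon[of N] N by (auto simp: lower_ms_def)
    from span_diff[OF span_base[OF imageI[OF N]] this]
    show "mon N \<in> span (mmon y ` lower_ms V)" by simp
  qed
qed

text \<open>The linear map from old to new monomials keeps leading terms, hence is injective, and so
  carries a basis to an independent family.\<close>

lemma thin_basis: "inj_on (mmon y) ms" "independent (mmon y ` ms)"
proof -
  interpret P: vector_space_pair scale scale by unfold_locales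
  obtain \<phi> where lin: "Vector_Spaces.linear scale scale \<phi>"
    and \<phi>: "\<forall>x\<in>mon ` ms. \<phi> x = (mmon y \<circ> inv_into ms mon) x"
    using P.linear_independent_extend[OF independent_mon] by blast
  interpret \<phi>: Vector_Spaces.linear scale scale \<phi> by (rule lin)
  have \<phi>_mon: "\<phi> (mon M) = mmon y M" if "M \<in> ms" for M
    using \<phi> that inv_into_f_f[OF inj_on_mon] by auto
  have "a = 0" if "\<phi> a = 0" for a
  proof (rule ccontr)
    assume "a \<noteq> 0"
    then obtain V k where V: "V \<in> ms" "k \<noteq> 0"
        and a: "a - scale k (mon V) \<in> span (mon ` {N \<in> ms. deg_less N V})"
      using leading_term[of a ms] span_mon by auto
    let ?K = "span (mon ` {N \<in> ms. deg_less N V})"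
    have "\<phi> b \<in> ?K" if "b \<in> ?K" for b
      using that
    proof (induction rule: span_induct_alt)
      case (step c x b)
      then obtain N where N: "N \<in> ms" "deg_less N V" "x = mon N" by blast
      have "span (mon ` {L \<in> ms. deg_less L N}) \<subseteq> ?K"
        using N deg_less_trans by (intro span_mono) blast
      then have "mmon y N - mon N \<in> ?K" using thin_mon_span_deg_less[OF N(1)] by blast
      then have "(mmon y N - mon N) + mon N \<in> ?K"
        using N by (intro span_add) (auto intro: span_base)
      then show ?case
        using step N \<phi>_mon by (simp add: \<phi>.add \<phi>.scale span_add span_scale)
    qed (simp add: \<phi>.zero span_zero)
    \<comment> \<open>As \<open>\<phi> a\<close> is zero, only the leading term remains. It forces
      \<open>mmon y V\<close>, and then \<open>mon V\<close>, into the span of the monomials below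
      \<open>V\<close>.\<close>
    from this[OF a] have "- scale k (mmon y V) \<in> ?K"
      using that V \<phi>_mon by (simp add: \<phi>.diff \<phi>.scale)
    from span_scale[OF this, of "- inverse k"] have "mmon y V \<in> ?K"
      using V(2) by simp
    from span_diff[OF this thin_mon_span_deg_less[OF V(1)]] show False
      using mon_notin_span_deg_less[OF V(1)] by simp
  qed
  then have inj: "inj \<phi>" using \<phi>.inj_iff_eq_0 by blast
  have eq: "mmon y ` ms = \<phi> ` mon ` ms" using \<phi>_mon by (auto simp: image_image)
  show "independent (mmon y ` ms)"
    unfolding eq by (rule \<phi>.independent_inj_image[OF independent_mon inj])
  have "inj_on (\<phi> \<circ> mon) ms"
    by (intro comp_inj_on inj_on_mon inj_on_subset[OF inj]) simp
  then show "inj_on (mmon y) ms" using \<phi>_mon by (simp add: inj_on_def)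
qed

text \<open>The scalar of the old family works again, because by \<open>thin_word\<close> both
  orders of the product change only by terms below \<open>{#\<eta>, \<xi>#}\<close>.\<close>

lemma thin_commute:
  assumes "\<eta> \<in> \<Xi>" "\<xi> \<in> \<Xi>" "\<eta> < \<xi>"
  obtains c where "c \<noteq> 0" "y \<xi> * y \<eta> - scale c (y \<eta> * y \<xi>) \<in> mon_span {#\<eta>, \<xi>#}"
proof -
  obtain c where c: "c \<noteq> 0" "z \<xi> * z \<eta> - scale c (z \<eta> * z \<xi>) \<in> mon_span {#\<eta>, \<xi>#}"
    using commute_in_mon_span[OF assms] .
  have 1: "y \<xi> * y \<eta> - z \<xi> * z \<eta> \<in> mon_span {#\<eta>, \<xi>#}"
    using thin_word[of "[\<xi>, \<eta>]"] assms by (simp add: word_span_eq_mon_span add_mset_commute)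
  have 2: "y \<eta> * y \<xi> - z \<eta> * z \<xi> \<in> mon_span {#\<eta>, \<xi>#}"
    using thin_word[of "[\<eta>, \<xi>]"] assms by (simp add: word_span_eq_mon_span)
  have "(z \<xi> * z \<eta> - scale c (z \<eta> * z \<xi>)) + (y \<xi> * y \<eta> - z \<xi> * z \<eta>)
      - scale c (y \<eta> * y \<xi> - z \<eta> * z \<xi>) \<in> mon_span {#\<eta>, \<xi>#}"
    by (rule subspace_diff[OF subspace_mon_span subspace_add[OF subspace_mon_span c(2) 1]
          subspace_scale[OF subspace_mon_span 2]])
  then have "y \<xi> * y \<eta> - scale c (y \<eta> * y \<xi>) \<in> mon_span {#\<eta>, \<xi>#}"
    by (simp add: scale_right_diff_distrib)
  then show thesis using that c(1) by blast
qed

section \<open>PBW bases of subalgebras\<close>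

text \<open>By \<open>lead\<close>, a multiple of \<open>mmon y V\<close> can be subtracted inside
  \<open>A\<close> from an element with leading monomial \<open>mon V\<close>, and well-founded
  descent exhausts the element. For triangularity, the commutation error lies both in
  \<open>A\<close> and in a span of lower new monomials, and these two spans are
  intersected.\<close>

lemma pbw_subalgebra:
  assumes A: "subalgebra scale A" and X: "X \<subseteq> \<Xi>" "\<And>\<xi>. \<xi> \<in> X \<Longrightarrow> y \<xi> \<in> A"
    and lead: "\<And>a V k. a \<in> A \<Longrightarrow> V \<in> ms \<Longrightarrow> k \<noteq> 0 \<Longrightarrow>
      a - scale k (mon V) \<in> span (mon ` {N \<in> ms. deg_less N V}) \<Longrightarrow> V \<in> multisets_on X"
  shows "pbw_system scale A X y" "triangular scale X y d"
proof -
  have subA: "subspace A" and A1: "1 \<in> A" and Amult: "\<And>a b. a \<in> A \<Longrightarrow> b \<in> A \<Longrightarrow> a * b \<in> A"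
    using A by (auto simp: subalgebra_def)
  have Xms: "multisets_on X \<subseteq> ms" using X(1) by (auto simp: multisets_on_def)
  have word: "word_prod y w \<in> A" if "set w \<subseteq> X" for w
    using that by (induction w) (auto intro: A1 Amult X)
  then have monA: "mmon y M \<in> A" if "M \<in> multisets_on X" for M
    using that by (simp add: mmon_def multisets_on_def)
  let ?S = "span (mmon y ` multisets_on X)"
  have *: "\<forall>a\<in>A. \<forall>k. a - scale k (mon V) \<in> span (mon ` {N \<in> ms. deg_less N V}) \<longrightarrow> a \<in> ?S"
    if "V \<in> ms" for V
    using that
  proof (induction V rule: ms_deg_less_induct)
    case (less V)
    show ?case
    proof (intro ballI allI impI)
      fix a k assume a: "a \<in> A" "a - scale k (mon V) \<in> span (mon ` {N \<in> ms. deg_less N V})"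
      define b where "b = a - scale k (mmon y V)"
      have kV: "scale k (mmon y V) \<in> ?S \<inter> A"
      proof (cases "k = 0")
        case True
        then show ?thesis using span_zero subspace_0[OF subA] by simp
      next
        case False
        then have "V \<in> multisets_on X" using lead a less(1) by blast
        then show ?thesis
          by (intro IntI span_scale subspace_scale[OF subA] span_base imageI monA)
      qed
      have bA: "b \<in> A" unfolding b_def using a(1) kV by (intro subspace_diff[OF subA]) auto
      \<comment> \<open>Exchanging \<open>mon V\<close> for \<open>mmon y V\<close> costs only terms
        below \<open>V\<close>, so the remainder \<open>b\<close> stays below
        \<open>V\<close>.\<close>
      have "a - scale k (mon V) - scale k (mmon y V - mon V) \<in> span (mon ` {N \<in> ms. deg_less N V})"
        by (rule span_diff[OF a(2) span_scale[OF thin_mon_span_deg_less[OF less(1)]]])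
      then have b: "b \<in> span (mon ` {N \<in> ms. deg_less N V})"
        by (simp add: b_def scale_right_diff_distrib)
      have "b \<in> ?S"
      proof (cases "b = 0")
        case False
        obtain U l where U: "U \<in> {N \<in> ms. deg_less N V}" "l \<noteq> 0"
            "b - scale l (mon U) \<in> span (mon ` {N \<in> {N \<in> ms. deg_less N V}. deg_less N U})"
          using leading_term[OF b False] by blast
        have "b - scale l (mon U) \<in> span (mon ` {N \<in> ms. deg_less N U})"
          using U(3) by (rule subsetD[OF span_mono, rotated]) auto
        then show ?thesis using less(2)[of U] U(1) bA by blast
      qed (simp add: span_zero)
      then have "b + scale k (mmon y V) \<in> ?S" using kV by (intro span_add) auto
      then show "a \<in> ?S" by (simp add: b_def)
    qed
  qed
  have "A \<subseteq> ?S"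
  proof
    fix a assume "a \<in> A"
    show "a \<in> ?S"
    proof (cases "a = 0")
      case False
      then obtain V k where "V \<in> ms" "k \<noteq> 0" "a - scale k (mon V) \<in> span (mon ` {N \<in> ms. deg_less N V})"
        using leading_term[of a ms] span_mon by auto
      then show ?thesis using * \<open>a \<in> A\<close> by blast
    qed (simp add: span_zero)
  qed
  moreover have "?S \<subseteq> A" using monA by (intro span_minimal subA) auto
  ultimately have spanA: "?S = A" by blast
  show "pbw_system scale A X y"
    unfolding pbw_system_iff using spanA
    by (intro conjI inj_on_subset[OF thin_basis(1) Xms]
        independent_mono[OF thin_basis(2) image_mono[OF Xms]])
  show "triangular scale X y d"
    unfolding triangular_def
  proof (intro conjI allI ballI impI)
    fix \<gamma>
    have "wfp_on {\<xi>\<in>\<Xi>. d \<xi> = \<gamma>} (<)" using triangular by (simp add: triangular_def)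
    then show "wfp_on {\<xi>\<in>X. d \<xi> = \<gamma>} (<)"
      by (rule wfp_on_subset) (use X(1) in auto)
  next
    fix \<eta> \<xi> assume "\<eta> \<in> X" "\<xi> \<in> X" "\<eta> < \<xi>"
    then obtain c where c: "c \<noteq> 0" "y \<xi> * y \<eta> - scale c (y \<eta> * y \<xi>) \<in> mon_span {#\<eta>, \<xi>#}"
      using thin_commute[of \<eta> \<xi>] X(1) by blast
    let ?x = "y \<xi> * y \<eta> - scale c (y \<eta> * y \<xi>)"
    have V: "{#\<eta>, \<xi>#} \<in> ms" using \<open>\<eta> \<in> X\<close> \<open>\<xi> \<in> X\<close> X(1) by auto
    have "?x \<in> A" using \<open>\<eta> \<in> X\<close> \<open>\<xi> \<in> X\<close>
      by (intro subspace_diff[OF subA] subspace_scale[OF subA] Amult X(2))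
    then have "?x \<in> ?S" using spanA by simp
    moreover have "?x \<in> span (mmon y ` lower_ms {#\<eta>, \<xi>#})" using thin_span_lower_ms[OF V] c(2) by blast
    moreover have "lower_ms {#\<eta>, \<xi>#} \<subseteq> ms" by (auto simp: lower_ms_def)
    \<comment> \<open>Both spans come from parts of one independent family, the new monomials over
      \<Xi>; hence lower monomials in letters of \<open>X\<close> suffice.\<close>
    ultimately have "?x \<in> span (mmon y ` multisets_on X \<inter> mmon y ` lower_ms {#\<eta>, \<xi>#})"
      using Xms by (intro independent_span_Int[OF thin_basis(2)]) auto
    also have "mmon y ` multisets_on X \<inter> mmon y ` lower_ms {#\<eta>, \<xi>#}
        = mmon y ` (multisets_on X \<inter> lower_ms {#\<eta>, \<xi>#})"
      using Xms \<open>lower_ms {#\<eta>, \<xi>#} \<subseteq> ms\<close> by (intro inj_on_image_Int[symmetric, OF thin_basis(1)])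
    also have "multisets_on X \<inter> lower_ms {#\<eta>, \<xi>#} = {N \<in> multisets_on X. N \<noteq> {#} \<and>
        N < mset [\<eta>, \<xi>] \<and> deg N \<le> deg (mset [\<eta>, \<xi>])}"
      using Xms by (auto simp: lower_ms_def)
    also have "span (mmon y ` \<dots>) = lower_span_pos scale X y d [\<eta>, \<xi>]"
      using \<open>\<eta> < \<xi>\<close> by (subst lower_span_pos_eq) auto
    finally show "\<exists>c. c \<noteq> 0 \<and> y \<xi> * y \<eta> - scale c (y \<eta> * y \<xi>) \<in> lower_span_pos scale X y d [\<eta>, \<xi>]"
      using c(1) by blast
  qed
qed

end

end

section \<open>Splittings of a word into two subwords\<close>

text \<open>One pair of complementary subwords for each set of positions; a list keeps the
  multiplicity of equal pairs.\<close>

primrec splits :: "'i list \<Rightarrow> ('i list \<times> 'i list) list" where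
  "splits [] = [([], [])]"
| "splits (x # w) = map (\<lambda>(p, q). (x # p, q)) (splits w) @ map (\<lambda>(p, q). (p, x # q)) (splits w)"

lemma mset_splits: "(p, q) \<in> set (splits w) \<Longrightarrow> mset p + mset q = mset w"
  by (induction w arbitrary: p q) auto

lemma set_splits: "(p, q) \<in> set (splits w) \<Longrightarrow> set p \<subseteq> set w \<and> set q \<subseteq> set w"
  by (induction w arbitrary: p q) fastforce+

lemma sorted_splits: "(p, q) \<in> set (splits w) \<Longrightarrow> sorted w \<Longrightarrow> sorted p \<and> sorted q"
proof (induction w arbitrary: p q)
  case (Cons x w)
  then show ?case using set_splits by fastforce
qed auto

lemma splits_Nil_self: "([], w) \<in> set (splits w)"
  by (induction w) force+

lemma splits_singleton: "x \<in> set w \<Longrightarrow> \<exists>q. ([x], q) \<in> set (splits w)"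
proof (induction w)
  case (Cons y w)
  then show ?case
  proof (cases "x = y")
    case True
    then show ?thesis using splits_Nil_self[of w] by force
  next
    case False
    then obtain q where "([x], q) \<in> set (splits w)" using Cons by auto
    then show ?thesis by force
  qed
qed simp

lemma (in vector_space) sum_list_if_const:
  "(\<Sum>x\<leftarrow>xs. if P x then v else 0) = scale (of_nat (length (filter P xs))) v"
  by (induction xs) (simp_all add: scale_left_distrib)

section \<open>The homomorphism \<Delta> up to lower terms\<close>

text \<open>The tensor product is recorded by its multiplication and by the slice maps id \<otimes>
  f. These data exist for \<open>tens\<close> and for its flip, so one argument treats both
  conditions on \<open>A\<close>.\<close>

locale pbw_comult = pbw_algebra scale \<Xi> z d + T: algebra_over scaleT
  for scale :: "'k::field_char_0 \<Rightarrow> 'h::ring_1 \<Rightarrow> 'h"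
    and \<Xi> :: "'i::linorder set" and z :: "'i \<Rightarrow> 'h"
    and d :: "'i \<Rightarrow> 'g::{comm_monoid_add,wellorder}"
    and scaleT :: "'k \<Rightarrow> 't::ring_1 \<Rightarrow> 't" +
  fixes t :: "'h \<Rightarrow> 'h \<Rightarrow> 't" and \<Delta> :: "'h \<Rightarrow> 't"
  assumes t_one: "t 1 1 = 1"
    and t_mult: "\<And>a b a' b'. t a b * t a' b' = t (a * a') (b * b')"
    and slice: "\<And>f. Vector_Spaces.linear scale (*) f \<Longrightarrow>
      \<exists>L. Vector_Spaces.linear scaleT scale L \<and> (\<forall>x y. L (t x y) = scale (f y) x)"
    and Delta: "algebra_hom scale scaleT \<Delta>"
    and dominated: "dominated scaleT t \<Delta> \<Xi> z d"
begin

text \<open>A filtration by the joint letter content of both legs. As the legs may be unsorted,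
  products keep this form without straightening.\<close>

definition tensor_span :: "('i multiset \<Rightarrow> bool) \<Rightarrow> 't set" where
  "tensor_span P = T.span {t (word_prod z p) (word_prod z q) | p q.
     set p \<subseteq> \<Xi> \<and> set q \<subseteq> \<Xi> \<and> P (mset p + mset q)}"

text \<open>The value that \<Delta> would take on the word if all its letters were
  primitive.\<close>

definition split_sum :: "'i list \<Rightarrow> 't" where
  "split_sum w = (\<Sum>(p, q)\<leftarrow>splits w. t (word_prod z p) (word_prod z q))"

lemma tensor_span_base: "set p \<subseteq> \<Xi> \<Longrightarrow> set q \<subseteq> \<Xi> \<Longrightarrow> P (mset p + mset q) \<Longrightarrow>
    t (word_prod z p) (word_prod z q) \<in> tensor_span P"
  unfolding tensor_span_def by (rule T.span_base) blast

lemma tensor_span_mono: "(\<And>M. P M \<Longrightarrow> Q M) \<Longrightarrow> tensor_span P \<subseteq> tensor_span Q"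
  unfolding tensor_span_def by (rule T.span_mono) blast

lemma tensor_span_mult:
  assumes "x \<in> tensor_span P" "y \<in> tensor_span Q" and PQ: "\<And>M N. P M \<Longrightarrow> Q N \<Longrightarrow> R (M + N)"
  shows "x * y \<in> tensor_span R"
  unfolding tensor_span_def
proof (rule T.span_mult[OF assms(1,2)[unfolded tensor_span_def]], clarify)
  fix p q p' q'
  assume "set p \<subseteq> \<Xi>" "set q \<subseteq> \<Xi>" "P (mset p + mset q)"
    "set p' \<subseteq> \<Xi>" "set q' \<subseteq> \<Xi>" "Q (mset p' + mset q')"
  then have "t (word_prod z (p @ p')) (word_prod z (q @ q')) \<in> tensor_span R"
    using PQ[of "mset p + mset q" "mset p' + mset q'"] by (intro tensor_span_base) (auto simp: ac_simps)
  then show "t (word_prod z p) (word_prod z q) * t (word_prod z p') (word_prod z q') \<in>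
      T.span {t (word_prod z p) (word_prod z q) | p q.
        set p \<subseteq> \<Xi> \<and> set q \<subseteq> \<Xi> \<and> R (mset p + mset q)}"
    by (simp add: t_mult tensor_span_def)
qed

lemma tensor_span_add: "x \<in> tensor_span P \<Longrightarrow> y \<in> tensor_span P \<Longrightarrow> x + y \<in> tensor_span P"
  and tensor_span_scale: "x \<in> tensor_span P \<Longrightarrow> scaleT c x \<in> tensor_span P"
  and tensor_span_zero: "0 \<in> tensor_span P"
  by (simp_all add: tensor_span_def T.span_add T.span_scale T.span_zero)

lemma split_sum_Cons: "split_sum (x # w) = (t 1 (z x) + t (z x) 1) * split_sum w"
proof -
  have 1: "t (z x) 1 * split_sum w
      = (\<Sum>(p, q)\<leftarrow>map (\<lambda>(p, q). (x # p, q)) (splits w). t (word_prod z p) (word_prod z q))"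
    unfolding split_sum_def
    by (simp add: sum_list_const_mult[symmetric] comp_def case_prod_unfold t_mult)
  have 2: "t 1 (z x) * split_sum w
      = (\<Sum>(p, q)\<leftarrow>map (\<lambda>(p, q). (p, x # q)) (splits w). t (word_prod z p) (word_prod z q))"
    unfolding split_sum_def
    by (simp add: sum_list_const_mult[symmetric] comp_def case_prod_unfold t_mult)
  show ?thesis
    unfolding distrib_right 1 2 by (simp add: split_sum_def add.commute)
qed

lemma split_sum_in_tensor_span:
  assumes "set w \<subseteq> \<Xi>"
  shows "split_sum w \<in> tensor_span (\<lambda>M. M = mset w)"
proof -
  have "(\<Sum>(p, q)\<leftarrow>ps. t (word_prod z p) (word_prod z q)) \<in> tensor_span (\<lambda>M. M = mset w)"
    if "set ps \<subseteq> set (splits w)" for ps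
    using that
  proof (induction ps)
    case (Cons pq ps)
    obtain p q where pq: "pq = (p, q)" by (cases pq)
    have "t (word_prod z p) (word_prod z q) \<in> tensor_span (\<lambda>M. M = mset w)"
      using Cons.prems pq assms set_splits[of p q w] mset_splits[of p q w]
      by (intro tensor_span_base) auto
    then show ?case using Cons pq by (simp add: tensor_span_add)
  qed (simp add: tensor_span_zero)
  then show ?thesis by (simp add: split_sum_def)
qed

text \<open>Domination makes all letters of both legs smaller than \<open>x\<close>, so even their
  joint multiset lies below the single letter \<open>x\<close>; the degree bound then gives
  \<open>deg_less\<close>.\<close>

lemma Delta_generator:
  assumes "x \<in> \<Xi>"
  shows "\<Delta> (z x) - (t 1 (z x) + t (z x) 1) \<in> tensor_span (\<lambda>M. deg_less M {#x#})"
proof -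
  have "{t (word_prod z P) (word_prod z Q) | P Q.
           P \<in> nd_words_pos \<Xi> \<and> Q \<in> nd_words_pos \<Xi> \<and>
           word_deg d (P @ Q) \<le> d x \<and> less_r P [x] \<and> less_r Q [x]}
      \<subseteq> tensor_span (\<lambda>M. deg_less M {#x#})"
  proof clarify
    fix P Q assume PQ: "P \<in> nd_words_pos \<Xi>" "Q \<in> nd_words_pos \<Xi>"
      "word_deg d (P @ Q) \<le> d x" "less_r P [x]" "less_r Q [x]"
    then have "\<forall>y\<in>#mset P + mset Q. y < x"
      using less_r_singleton[of P x] less_r_singleton[of Q x]
      by (auto simp: nd_words_pos_def nd_words_def)
    then have "mset P + mset Q < {#x#}" by (subst mset_lt_single_right_iff)
    then have "deg_less (mset P + mset Q) {#x#}"
      using PQ(3) by (auto simp: deg_less_def word_deg_eq)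
    then show "t (word_prod z P) (word_prod z Q) \<in> tensor_span (\<lambda>M. deg_less M {#x#})"
      using PQ by (intro tensor_span_base) (auto simp: nd_words_pos_def nd_words_def)
  qed
  then have "T.span {t (word_prod z P) (word_prod z Q) | P Q.
           P \<in> nd_words_pos \<Xi> \<and> Q \<in> nd_words_pos \<Xi> \<and>
           word_deg d (P @ Q) \<le> d x \<and> less_r P [x] \<and> less_r Q [x]}
      \<subseteq> tensor_span (\<lambda>M. deg_less M {#x#})"
    by (rule T.span_minimal) (simp add: tensor_span_def)
  then show ?thesis
    using dominated assms unfolding dominated_def by blast
qed

lemma Delta_linear: "Vector_Spaces.linear scale scaleT \<Delta>"
  and Delta_one: "\<Delta> 1 = 1" and Delta_mult: "\<Delta> (a * b) = \<Delta> a * \<Delta> b"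
  using Delta by (simp_all add: algebra_hom_def)

text \<open>With \<open>?E\<close> the primitive part of \<open>\<Delta> (z x)\<close>, the error of
  \<open>x # w\<close> is the error of \<open>x\<close> times \<Delta> of \<open>w\<close>, plus
  \<open>?E\<close> times the error of \<open>w\<close>. Each product has a strictly lower factor,
  and \<open>deg_less\<close> is compatible with addition.\<close>

lemma Delta_word:
  assumes "set w \<subseteq> \<Xi>"
  shows "\<Delta> (word_prod z w) - split_sum w \<in> tensor_span (\<lambda>M. deg_less M (mset w))"
  using assms
proof (induction w)
  case Nil
  then show ?case by (simp add: split_sum_def Delta_one t_one tensor_span_zero)
next
  case (Cons x w)
  let ?le = "\<lambda>V M. M = V \<or> deg_less M V"
  let ?E = "t 1 (z x) + t (z x) 1"
  have x: "x \<in> \<Xi>" and w: "set w \<subseteq> \<Xi>" using Cons.prems by auto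
  have E: "?E \<in> tensor_span (\<lambda>M. M = {#x#})"
    using tensor_span_base[of "[]" "[x]" "\<lambda>M. M = {#x#}"] tensor_span_base[of "[x]" "[]" "\<lambda>M. M = {#x#}"] x
    by (intro tensor_span_add) auto
  have IH: "\<Delta> (word_prod z w) - split_sum w \<in> tensor_span (\<lambda>M. deg_less M (mset w))"
    using Cons.IH w .
  have "tensor_span (\<lambda>M. M = mset w) \<subseteq> tensor_span (?le (mset w))" "tensor_span (\<lambda>M. deg_less M (mset w)) \<subseteq> tensor_span (?le (mset w))"
    by (auto intro!: tensor_span_mono)
  then have "(\<Delta> (word_prod z w) - split_sum w) + split_sum w \<in> tensor_span (?le (mset w))"
    using IH split_sum_in_tensor_span[OF w] by (intro tensor_span_add) auto
  then have D: "\<Delta> (word_prod z w) \<in> tensor_span (?le (mset w))" by simp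
  have "(\<Delta> (z x) - ?E) * \<Delta> (word_prod z w) \<in> tensor_span (\<lambda>M. deg_less M (mset (x # w)))"
  proof (rule tensor_span_mult[OF Delta_generator[OF x] D])
    fix M N assume "deg_less M {#x#}" "N = mset w \<or> deg_less N (mset w)"
    then have "deg_less (M + N) ({#x#} + N)" "{#x#} + N = {#x#} + mset w \<or> deg_less ({#x#} + N) ({#x#} + mset w)"
      using deg_less_add[of M "{#x#}" N] deg_less_add[of N "mset w" "{#x#}"] by (auto simp: add.commute)
    then show "deg_less (M + N) (mset (x # w))" using deg_less_trans by auto
  qed
  moreover have "?E * (\<Delta> (word_prod z w) - split_sum w) \<in> tensor_span (\<lambda>M. deg_less M (mset (x # w)))"
  proof (rule tensor_span_mult[OF E IH])
    fix M N assume "M = {#x#}" "deg_less N (mset w)"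
    then show "deg_less (M + N) (mset (x # w))"
      using deg_less_add[of N "mset w" "{#x#}"] by simp
  qed
  ultimately have "(\<Delta> (z x) - ?E) * \<Delta> (word_prod z w) + ?E * (\<Delta> (word_prod z w) - split_sum w)
      \<in> tensor_span (\<lambda>M. deg_less M (mset (x # w)))"
    by (rule tensor_span_add)
  also have "(\<Delta> (z x) - ?E) * \<Delta> (word_prod z w) + ?E * (\<Delta> (word_prod z w) - split_sum w)
      = \<Delta> (z x) * \<Delta> (word_prod z w) - ?E * split_sum w"
    by (simp only: left_diff_distrib right_diff_distrib) simp
  finally show ?case
    by (simp add: split_sum_Cons Delta_mult)
qed

lemma Delta_span_deg_less:
  assumes "a \<in> span (mon ` {N \<in> ms. deg_less N V})"
  shows "\<Delta> a \<in> tensor_span (\<lambda>M. deg_less M V)"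
proof -
  interpret D: Vector_Spaces.linear scale scaleT \<Delta> by (rule Delta_linear)
  show ?thesis
    using assms
  proof (induction rule: span_induct_alt)
    case (step c x a)
    then obtain N where N: "N \<in> ms" "deg_less N V" "x = mon N" by blast
    define w where "w = sorted_list_of_multiset N"
    have w: "set w \<subseteq> \<Xi>" "mset w = N" "x = word_prod z w"
      using N by (simp_all add: w_def mmon_def multisets_on_def)
    have "tensor_span (\<lambda>M. deg_less M N) \<subseteq> tensor_span (\<lambda>M. deg_less M V)" "tensor_span (\<lambda>M. M = N) \<subseteq> tensor_span (\<lambda>M. deg_less M V)"
      using N(2) deg_less_trans by (auto intro!: tensor_span_mono)
    then have "(\<Delta> x - split_sum w) + split_sum w \<in> tensor_span (\<lambda>M. deg_less M V)"
      using Delta_word[OF w(1)] split_sum_in_tensor_span[OF w(1)] w by (intro tensor_span_add) auto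
    then show ?case
      using step by (simp add: D.add D.scale tensor_span_add tensor_span_scale)
  qed (simp add: D.zero tensor_span_zero)
qed

section \<open>Letters of leading monomials\<close>

text \<open>The slice map \<open>L\<close> keeps \<open>\<Delta> a\<close> in \<open>A\<close>,
  sends a splitting of \<open>V\<close> to \<open>z \<xi>\<close> or to 0 according to its right
  leg, and sends everything lower into \<open>lower_span\<close> at \<xi>.\<close>

lemma leading_letter_in_sub_index:
  assumes A: "subalgebra scale A" "\<Delta> ` A \<subseteq> T.span {t a h | a h. a \<in> A}"
    and a: "a \<in> A" "a - scale k (mon V) \<in> span (mon ` {N \<in> ms. deg_less N V})"
    and V: "V \<in> ms" "k \<noteq> 0" "\<xi> \<in># V"
  shows "\<xi> \<in> sub_index scale A \<Xi> z d"
proof -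
  have subA: "subspace A" using A(1) by (simp add: subalgebra_def)
  have \<xi>: "\<xi> \<in> \<Xi>" using V by (auto simp: multisets_on_def)
  obtain Q where Q: "V = add_mset \<xi> Q" using V(3) by (metis insert_DiffM)
  have Qms: "Q \<in> ms" using Q V(1) by simp
  define f where "f v = representation (mon ` ms) v (mon Q)" for v
  have lin_f: "Vector_Spaces.linear scale (*) f"
    unfolding f_def by (rule linear_representation[OF independent_mon span_mon])
  interpret f: Vector_Spaces.linear scale "(*)" f by (rule lin_f)
  have f_mon: "f (mon M) = (if M = Q then 1 else 0)" if "M \<in> ms" for M
    using that Qms inj_onD[OF inj_on_mon, of M Q]
    by (auto simp: f_def representation_basis[OF independent_mon])
  obtain L where lin_L: "Vector_Spaces.linear scaleT scale L"
    and L_t: "\<And>x y. L (t x y) = scale (f y) x"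
    using slice[OF lin_f] by blast
  interpret L: Vector_Spaces.linear scaleT scale L by (rule lin_L)
  interpret D: Vector_Spaces.linear scale scaleT \<Delta> by (rule Delta_linear)
  let ?low = "lower_span scale \<Xi> z d [\<xi>]"
  have low: "?low = span (mon ` {N \<in> ms. N < {#\<xi>#} \<and> deg N \<le> d \<xi>})"
    by (rule lower_span_singleton_eq)
  have sub_low: "subspace ?low" unfolding low by simp

  have L_A: "L x \<in> A" if "x \<in> T.span {t a h | a h. a \<in> A}" for x
    using that
  proof (induction rule: T.span_induct_alt)
    case (step c x y)
    then show ?case
      by (auto simp: L.add L.scale L_t intro!: subspace_add[OF subA] subspace_scale[OF subA])
  qed (simp add: L.zero subspace_0[OF subA])

  \<comment> \<open>Sorting the left leg only brings in lower monomials, and below a single letter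
    \<open>deg_less\<close> yields both bounds of \<open>?low\<close>.\<close>
  have word_low: "word_prod z p \<in> ?low" if p: "set p \<subseteq> \<Xi>" "deg_less (mset p) {#\<xi>#}" for p
  proof -
    have "insert (mset p) (lower_ms (mset p)) \<subseteq> {N \<in> ms. N < {#\<xi>#} \<and> deg N \<le> d \<xi>}"
    proof
      fix N assume "N \<in> insert (mset p) (lower_ms (mset p))"
      then have "N \<in> ms" "deg_less N {#\<xi>#}"
        using p lower_ms_deg_less[of N "mset p"] deg_less_trans[of N "mset p"] by (auto simp: lower_ms_def)
      then show "N \<in> {N \<in> ms. N < {#\<xi>#} \<and> deg N \<le> d \<xi>}"
        using deg_less_singleton_imp_less[OF _ \<xi>] by blast
    qed
    then show ?thesis
      unfolding low using word_prod_in_span[OF p(1)] span_mono[OF image_mono] by blast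
  qed

  \<comment> \<open>Straightening never raises the content, so \<open>mon Q\<close> can only come
    from words of content at least \<open>Q\<close>.\<close>
  have f_word: "Q = mset q \<or> deg_less Q (mset q)" if q: "set q \<subseteq> \<Xi>" "f (word_prod z q) \<noteq> 0" for q
  proof (rule ccontr)
    assume *: "\<not> ?thesis"
    have "f v = 0" if "v \<in> span (mon ` insert (mset q) (lower_ms (mset q)))" for v
      using that
    proof (induction rule: span_induct_alt)
      case (step c x y)
      then obtain M where M: "x = mon M" "M = mset q \<or> M \<in> lower_ms (mset q)" by blast
      have "M \<in> ms" using M(2) q(1) by (auto simp: lower_ms_def)
      moreover have "M \<noteq> Q" using M(2) * lower_ms_deg_less by auto
      ultimately show ?case using step.IH M(1) f_mon by (simp add: f.add f.scale)
    qed (rule f.zero)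
    then show False using q(2) word_prod_in_span[OF q(1)] by blast
  qed

  have L_tensor_span: "L x \<in> ?low" if "x \<in> tensor_span (\<lambda>M. deg_less M V)" for x
    using that unfolding tensor_span_def
  proof (induction rule: T.span_induct_alt)
    case (step c x y)
    then obtain p q where pq: "x = t (word_prod z p) (word_prod z q)" "set p \<subseteq> \<Xi>" "set q \<subseteq> \<Xi>"
      "deg_less (mset p + mset q) V" by blast
    have "L x \<in> ?low"
    proof (cases "f (word_prod z q) = 0")
      case True
      then show ?thesis by (simp add: pq L_t subspace_0[OF sub_low])
    next
      case False
      \<comment> \<open>Replacing \<open>mset q\<close> by the smaller or equal \<open>Q\<close>
        stays below \<open>V\<close>, and then \<open>Q\<close> cancels on both sides.\<close>
      from f_word[OF pq(3) this] have "deg_less (mset p + Q) ({#\<xi>#} + Q)"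
        using pq(4) deg_less_add[of Q "mset q" "mset p"] deg_less_trans Q
        by (auto simp: add.commute)
      then have "deg_less (mset p) {#\<xi>#}" by (simp only: deg_less_add_cancel)
      then show ?thesis
        unfolding pq L_t by (intro subspace_scale[OF sub_low] word_low pq)
    qed
    then show ?case
      using step.IH by (simp add: L.add L.scale subspace_add[OF sub_low] subspace_scale[OF sub_low])
  qed (simp add: L.zero subspace_0[OF sub_low])

  define w where "w = sorted_list_of_multiset V"
  have w: "sorted w" "mset w = V" "set w \<subseteq> \<Xi>" "word_prod z w = mon V"
    using V(1) by (simp_all add: w_def mmon_def multisets_on_def)
  \<comment> \<open>This counts the choices of one \<xi> for the left leg, that is, the multiplicity
    of \<xi> in \<open>V\<close>.\<close>
  define n where "n = length (filter (\<lambda>(p, q). mset q = Q) (splits w))"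
  have "L (split_sum w) = (\<Sum>(p, q)\<leftarrow>splits w. scale (f (word_prod z q)) (word_prod z p))"
  proof -
    have "L (sum_list xs) = sum_list (map L xs)" for xs
      by (induction xs) (simp_all add: L.zero L.add)
    then show ?thesis
      by (simp add: split_sum_def L_t comp_def case_prod_unfold)
  qed
  \<comment> \<open>Both legs are sorted, so \<open>f\<close> takes only the values 0 and 1, and a
    right leg of content \<open>Q\<close> leaves the one-letter word \<xi> on the left.\<close>
  also have "\<dots> = (\<Sum>pq\<leftarrow>splits w. if (case pq of (p, q) \<Rightarrow> mset q = Q) then z \<xi> else 0)"
  proof (intro arg_cong[of _ _ sum_list] map_cong refl, clarify)
    fix p q assume pq: "(p, q) \<in> set (splits w)"
    have "sorted q" "set q \<subseteq> \<Xi>" "mset p + mset q = V"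
      using sorted_splits[OF pq w(1)] set_splits[OF pq] mset_splits[OF pq] w by auto
    moreover from this have "f (word_prod z q) = (if mset q = Q then 1 else 0)"
      using f_mon[of "mset q"] by (simp add: mmon_mset)
    moreover have "p = [\<xi>]" if "mset q = Q"
    proof -
      have "mset p = {#\<xi>#}" using \<open>mset p + mset q = V\<close> that Q by simp
      then show ?thesis by simp
    qed
    ultimately show "scale (f (word_prod z q)) (word_prod z p) = (if mset q = Q then z \<xi> else 0)"
      by simp
  qed
  also have "\<dots> = scale (of_nat n) (z \<xi>)"
    unfolding n_def by (rule sum_list_if_const)
  finally have L_split: "L (split_sum w) = scale (of_nat n) (z \<xi>)" .
  have "n \<noteq> 0"
  proof -
    obtain q where q: "([\<xi>], q) \<in> set (splits w)"
      using splits_singleton[of \<xi> w] V(3) w(2) by auto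
    then have "mset q = Q" using mset_splits[OF q] w(2) Q by simp
    then have "filter (\<lambda>(p, q). mset q = Q) (splits w) \<noteq> []"
      using q by (auto simp: filter_empty_conv)
    then show ?thesis by (simp add: n_def)
  qed
  define c where "c = k * of_nat n"
  \<comment> \<open>Characteristic zero enters here: \<open>of_nat n\<close> does not vanish in the
    field.\<close>
  have c: "c \<noteq> 0" using \<open>n \<noteq> 0\<close> V(2) by (simp add: c_def)

  define r where "r = a - scale k (mon V)"
  have "\<Delta> a = scaleT k (split_sum w) + (scaleT k (\<Delta> (word_prod z w) - split_sum w) + \<Delta> r)"
    by (simp add: r_def w D.diff D.scale T.scale_right_diff_distrib)
  moreover define e where "e = L (scaleT k (\<Delta> (word_prod z w) - split_sum w) + \<Delta> r)"
  ultimately have La: "L (\<Delta> a) = scale c (z \<xi>) + e"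
    by (simp add: L.add L.scale L_split c_def)
  have "e \<in> ?low"
    unfolding e_def
    using Delta_word[OF w(3)] Delta_span_deg_less[OF a(2)] w(2)
    by (intro L_tensor_span tensor_span_add tensor_span_scale) (simp_all add: r_def)
  then have e: "scale (inverse c) e \<in> ?low" by (rule subspace_scale[OF sub_low])
  have "L (\<Delta> a) \<in> A" using A(2) a(1) by (intro L_A) blast
  then have "scale (inverse c) (scale c (z \<xi>) + e) \<in> A"
    unfolding La by (rule subspace_scale[OF subA])
  then have "z \<xi> + scale (inverse c) e \<in> A"
    using c by (simp add: scale_right_distrib)
  then show ?thesis
    using e \<xi> unfolding sub_index_def by blast
qed

lemma pbw_sub_index:
  assumes A: "subalgebra scale A" "\<Delta> ` A \<subseteq> T.span {t a h | a h. a \<in> A}"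
    and y: "thin_replacement scale \<Xi> z d y" "\<And>\<xi>. \<xi> \<in> sub_index scale A \<Xi> z d \<Longrightarrow> y \<xi> \<in> A"
  shows "pbw_system scale A (sub_index scale A \<Xi> z d) y \<and>
    triangular scale (sub_index scale A \<Xi> z d) y d"
proof -
  have "sub_index scale A \<Xi> z d \<subseteq> \<Xi>" by (auto simp: sub_index_def)
  moreover have "V \<in> multisets_on (sub_index scale A \<Xi> z d)"
    if "a \<in> A" "V \<in> ms" "k \<noteq> 0" "a - scale k (mon V) \<in> span (mon ` {N \<in> ms. deg_less N V})" for a V k
    using leading_letter_in_sub_index[OF A] that by (auto simp: multisets_on_def)
  ultimately show ?thesis
    using pbw_subalgebra[OF y(1) A(1) _ y(2)] by blast
qed

end

section \<open>Slice maps and the two coideal conditions\<close>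

text \<open>These are id \<otimes> f and f \<otimes> id: \<open>scale (f y) x\<close> is linear in
  each variable, so the universal property supplies both maps.\<close>

lemma tensor_slice:
  assumes T: "is_tensor_product scale scale scaleT tens"
    and f: "Vector_Spaces.linear scale (*) f"
  shows "\<exists>L. Vector_Spaces.linear scaleT scale L \<and> (\<forall>x y. L (tens x y) = scale (f y) x)"
    and "\<exists>L. Vector_Spaces.linear scaleT scale L \<and> (\<forall>x y. L (tens y x) = scale (f y) x)"
proof -
  have vs: "vector_space scale" using T by (simp add: is_tensor_product_def)
  interpret vector_space scale by (rule vs)
  interpret f: Vector_Spaces.linear scale "(*)" f by (rule f)
  have lin: "Vector_Spaces.linear scale scale (\<lambda>x. scale (f y) x)"
      "Vector_Spaces.linear scale scale (\<lambda>y. scale (f y) x)" for x y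
    using vs by (simp_all add: Vector_Spaces.linear_iff scale_right_distrib scale_left_distrib f.add f.scale
        mult.commute)
  show "\<exists>L. Vector_Spaces.linear scaleT scale L \<and> (\<forall>x y. L (tens x y) = scale (f y) x)"
    using tensor_product_universal[OF T vs, of "\<lambda>x y. scale (f y) x"] lin by blast
  show "\<exists>L. Vector_Spaces.linear scaleT scale L \<and> (\<forall>x y. L (tens y x) = scale (f y) x)"
    using tensor_product_universal[OF T vs, of "\<lambda>x y. scale (f x) y"] lin by metis
qed

text \<open>The conditions on \<open>P\<close> and \<open>Q\<close> are symmetric, since addition of
  degrees is commutative.\<close>

lemma dominated_flip:
  fixes d :: "'i::linorder \<Rightarrow> 'g::{comm_monoid_add,ord}"
  assumes "dominated scaleT tens \<Delta> \<Xi> z d"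
  shows "dominated scaleT (\<lambda>x y. tens y x) \<Delta> \<Xi> z d"
proof -
  have "{tens (word_prod z Q) (word_prod z P) | P Q.
           P \<in> nd_words_pos \<Xi> \<and> Q \<in> nd_words_pos \<Xi> \<and>
           word_deg d (P @ Q) \<le> d \<xi> \<and> less_r P [\<xi>] \<and> less_r Q [\<xi>]}
      = {tens (word_prod z P) (word_prod z Q) | P Q.
           P \<in> nd_words_pos \<Xi> \<and> Q \<in> nd_words_pos \<Xi> \<and>
           word_deg d (P @ Q) \<le> d \<xi> \<and> less_r P [\<xi>] \<and> less_r Q [\<xi>]}" for \<xi>
    by (force simp: word_deg_def add.commute)
  then show ?thesis
    using assms by (simp add: dominated_def add.commute)
qed

theorem theorem1p4:
  fixes scale :: "'k::field_char_0 \<Rightarrow> 'h::ring_1 \<Rightarrow> 'h"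
    and scaleT :: "'k \<Rightarrow> 't::ring_1 \<Rightarrow> 't"
    and tens :: "'h \<Rightarrow> 'h \<Rightarrow> 't"
    and \<Delta> :: "'h \<Rightarrow> 't"
    and A :: "'h set"
    and \<Xi> :: "'i::linorder set"
    and z z' :: "'i \<Rightarrow> 'h"
    and d :: "'i \<Rightarrow> 'g::{comm_monoid_add,wellorder}"
  assumes H: "algebra_over scale"
    and HH: "is_tensor_algebra scale scaleT tens"
    and pbw: "pbw_system scale UNIV \<Xi> z"
    and Delta: "algebra_hom scale scaleT \<Delta>"
    and A: "subalgebra scale A"
    and A_coideal:
      "\<Delta> ` A \<subseteq> module.span scaleT {tens a h | a h. a \<in> A} \<or>
       \<Delta> ` A \<subseteq> module.span scaleT {tens h a | h a. a \<in> A}"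
    and Gamma_nontrivial: "\<exists>\<gamma>::'g. \<gamma> \<noteq> 0"
    and Gamma_free: "\<exists>B::'g set. free_comm_monoid_on B"
    and Gamma_order: "\<And>\<gamma>1 \<gamma>2 \<gamma> :: 'g. \<gamma>1 < \<gamma>2 \<Longrightarrow> \<gamma>1 + \<gamma> < \<gamma>2 + \<gamma>"
    and d_mono: "mono_on \<Xi> d"
    and d_pos: "positive_on \<Xi> d"
    and triangular: "triangular scale \<Xi> z d"
    and dominated: "dominated scaleT tens \<Delta> \<Xi> z d"
    and thin: "thin_replacement scale \<Xi> z d z'"
    and z'_in_A: "\<And>\<xi>. \<xi> \<in> sub_index scale A \<Xi> z d \<Longrightarrow> z' \<xi> \<in> A"
  shows "pbw_system scale A (sub_index scale A \<Xi> z d) z' \<and>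
         triangular scale (sub_index scale A \<Xi> z d) z' d"
proof -
  have pbw_algebra: "pbw_algebra scale \<Xi> z d"
    using H pbw Gamma_order d_mono d_pos triangular
    by (simp add: pbw_algebra_def pbw_algebra_axioms_def)
  have T: "algebra_over scaleT" "is_tensor_product scale scale scaleT tens" "tens 1 1 = 1"
      "\<And>a b c d. tens a b * tens c d = tens (a * c) (b * d)"
    using HH by (auto simp: is_tensor_algebra_def)
  from A_coideal show ?thesis
  proof
    assume *: "\<Delta> ` A \<subseteq> module.span scaleT {tens a h | a h. a \<in> A}"
    interpret pbw_comult scale \<Xi> z d scaleT tens \<Delta>
      using pbw_algebra T Delta dominated tensor_slice(1)[OF T(2)]
      by (intro pbw_comult.intro pbw_comult_axioms.intro) auto
    show ?thesis using A * thin z'_in_A by (rule pbw_sub_index)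
  next
    assume "\<Delta> ` A \<subseteq> module.span scaleT {tens h a | h a. a \<in> A}"
    moreover have "{tens h a | h a. a \<in> A} = {tens h a | a h. a \<in> A}" by blast
    ultimately have *: "\<Delta> ` A \<subseteq> module.span scaleT {tens h a | a h. a \<in> A}" by simp
    \<comment> \<open>The flipped pairing is again multiplicative and unital, and for it the second
      condition on \<Delta> reads as the first.\<close>
    interpret pbw_comult scale \<Xi> z d scaleT "\<lambda>x y. tens y x" \<Delta>
      using pbw_algebra T Delta dominated_flip[OF dominated] tensor_slice(2)[OF T(2)]
      by (intro pbw_comult.intro pbw_comult_axioms.intro) auto
    show ?thesis using A * thin z'_in_A by (rule pbw_sub_index)
  qed
qed

end
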